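(* Suppose that $\mathbb{P}(N<\infty)=1$ and that there is an $\alpha\in(1,2]$ such that $$\mathbb{E}\Big[\sum_{|u|=1}|L(u)|^{\alpha}\Big]=1\quad\text{and}\quad \mathbb{E}\Big[\sum_{|u|=1}|L(u)|^{\alpha}\log(|L(u)|)\Big]\le 0,$$ and $$\mathbb{E}\Big[\sum_{|u|=1}|L(u)|^{\vartheta}\Big]<\infty\quad\text{for some }\vartheta\in[0,\alpha).$$ If $\mathbb{E}[|Z_1|^p]=\infty$ for some $p\in[1,\alpha)$, then the additive martingale $(Z_n)_{n\ge0}$, $Z_n=\sum_{|u|=n}L(u)$, does not converge in probability.
   Context: Let $d\in\mathbb{N}=\{1,2,\ldots\}$ and $\mathbb{N}_0=\mathbb{N}\cup\{0\}$. Let $\mathcal{Z}=\sum_{j=1}^{N}\delta_{X_j}$ be a point process on $\mathbb{R}^d$ with $N=\mathcal{Z}(\mathbb{R}^d)$ and intensity measure $\mu$. The process is supercritical: $\mu(\mathbb{R}^d)=\mathbb{E}[N]>1$. Let $\mathcal{I}=\bigcup_{n\ge0}\mathbb{N}^n$ be the set of finite tuples of positive integers, with empty tuple $\varnothing$ and concatenation $uv$. Let $(\mathcal{Z}(u))_{u\in\mathcal{I}}$ be i.i.d. copies of $\mathcal{Z}$ on a probability space $(\Omega,\mathcal{A},\mathbb{P})$, $\mathcal{Z}(u)=\sum_{i=1}^{N(u)}\delta_{X_i(u)}$. Generations are $\mathcal{G}_0=\{\varnothing\}$, $\mathcal{G}_{n+1}=\{uj: u\in\mathcal{G}_n,\ j\in\mathbb{N},\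 1\le j\le N(u)\}$; $|u|=n$ means $u\in\mathcal{G}_n$. The position of $u=u_1\ldots u_n\in\mathcal{G}_n$ is $S(u)=X_{u_1}(\varnothing)+\ldots+X_{u_n}(u_1\ldots u_{n-1})$, and $S(\varnothing)=0$. For $\lambda=\theta+\mathrm{i}\eta\in\mathbb{C}^d$ with $\theta,\eta\in\mathbb{R}^d$, put $m(\lambda)=\int e^{-\lambda x}\,\mu(dx)$, where $\lambda x=\sum_k\lambda_kx_k$, whenever this converges, i.e. for $\lambda\in\mathcal{D}=\{\theta\in\mathbb{R}^d:m(\theta)<\infty\}+\mathrm{i}\mathbb{R}^d$. It is assumed that the interior of $\mathcal{D}$ is non-empty. Fix $\lambda\in\mathcal{D}$ with $m(\lambda)\ne0$ and put $L(u)=m(\lambda)^{-n}e^{-\lambda S(u)}$ for $u\in\mathcal{G}_n$ (and $L(u)=0$ for $u\in\mathcal I$ in no generation), and $Z_n=\sum_{|u|=n}L(u)$, $n\in\mathbb{N}_0$. Then $(Z_n)_{n\ge0}$ is a complex martingale with respect to $\mathcal{F}_n=\sigma(\mathcal{Z}(u):u\in\mathbb{N}^k\text{ for some }k<n)$ ($\mathcal{F}_0$ trivial), with $\mathbb{E}[Z_1]=1$. It is assumed that $\mathbb{P}(Z_1=1)<1$. *)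

theory Defs
  imports "HOL-Probability.Probability"
begin

section \<open>Point processes and their Laplace transforms\<close>

text \<open>
  A point process is given by its enumeration: a total number of points
  \<open>N\<close>, possibly infinite, and positions \<open>X 1, X 2, \<dots>\<close>, of which only those with index
  \<open>j \<ge> 1\<close>, \<open>j \<le> N\<close> are used.
\<close>

definition labels :: "enat \<Rightarrow> nat set" where
  "labels n = {j. 1 \<le> j \<and> enat j \<le> n}"

text \<open>The random measure \<open>\<delta>\<^bsub>X 1\<^esub> + \<delta>\<^bsub>X 2\<^esub> + \<dots>\<close> (\<open>N\<close> terms) as the image of a counting measure.\<close>

definition point_process ::
  "('w \<Rightarrow> enat) \<Rightarrow> (nat \<Rightarrow> 'w \<Rightarrow> real ^ 'd) \<Rightarrow> 'w \<Rightarrow> (real ^ 'd) measure" where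
  "point_process N X \<omega> = distr (count_space (labels (N \<omega>))) borel (\<lambda>j. X j \<omega>)"

definition intensity ::
  "'w measure \<Rightarrow> ('w \<Rightarrow> enat) \<Rightarrow> (nat \<Rightarrow> 'w \<Rightarrow> real ^ 'd) \<Rightarrow> (real ^ 'd) measure" where
  "intensity M N X =
     measure_of UNIV (sets borel) (\<lambda>B. \<integral>\<^sup>+ \<omega>. emeasure (point_process N X \<omega>) B \<partial>M)"

lemma emeasure_point_process:
  assumes "B \<in> sets borel"
  shows "emeasure (point_process N X \<omega>) B = (\<Sum>j. indicator (labels (N \<omega>)) j * indicator B (X j \<omega>))"
proof -
  have "emeasure (point_process N X \<omega>) B = emeasure (count_space (labels (N \<omega>))) ((\<lambda>j. X j \<omega>) -` B \<inter> labels (N \<omega>))"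
    unfolding point_process_def using assms by (subst emeasure_distr) auto
  also have "\<dots> = (\<integral>\<^sup>+ j. indicator ((\<lambda>j. X j \<omega>) -` B \<inter> labels (N \<omega>)) j \<partial>count_space (labels (N \<omega>)))"
    by (subst nn_integral_indicator) auto
  also have "\<dots> = (\<integral>\<^sup>+ j. indicator (labels (N \<omega>)) j * indicator B (X j \<omega>) \<partial>count_space UNIV)"
    by (subst nn_integral_count_space_indicator) (auto intro!: nn_integral_cong simp: indicator_def)
  finally show ?thesis by (simp add: nn_integral_count_space_nat)
qed

text \<open>The set function in the definition of \<open>intensity\<close> is indeed a measure.\<close>

lemma emeasure_intensity:
  assumes [measurable]: "N \<in> measurable M (count_space UNIV)" "\<And>j. X j \<in> borel_measurable M"
    and B: "B \<in> sets borel"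
  shows "emeasure (intensity M N X) B = (\<integral>\<^sup>+ \<omega>. emeasure (point_process N X \<omega>) B \<partial>M)"
proof (rule emeasure_measure_of[OF intensity_def])
  have meas: "(\<lambda>\<omega>. emeasure (point_process N X \<omega>) C) \<in> borel_measurable M"
    if [measurable]: "C \<in> sets borel" for C
  proof -
    have [measurable]: "(\<lambda>\<omega>. indicator (labels (N \<omega>)) j :: ennreal) \<in> borel_measurable M" for j
      by (rule measurable_compose[of N M "count_space UNIV"]) auto
    show ?thesis by (subst emeasure_point_process) auto
  qed
  show "sets borel \<subseteq> Pow UNIV" by auto
  show "positive (sets (intensity M N X)) (\<lambda>B. \<integral>\<^sup>+ \<omega>. emeasure (point_process N X \<omega>) B \<partial>M)"
    by (auto simp: positive_def)
  show "countably_additive (sets (intensity M N X)) (\<lambda>B. \<integral>\<^sup>+ \<omega>. emeasure (point_process N X \<omega>) B \<partial>M)"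
  proof (rule countably_additiveI)
    fix A :: "nat \<Rightarrow> (real ^ 'b) set"
    assume A: "range A \<subseteq> sets (intensity M N X)" "disjoint_family A"
    have s: "sets (intensity M N X) = sets borel"
      unfolding intensity_def using sets.sigma_sets_eq[of "borel :: (real ^ 'b) measure"] by simp
    have A': "A i \<in> sets borel" for i using A s by auto
    have p: "(\<Sum>i. emeasure (point_process N X \<omega>) (A i)) = emeasure (point_process N X \<omega>) (\<Union>i. A i)" for \<omega>
      by (rule suminf_emeasure) (use A' A in \<open>auto simp: point_process_def\<close>)
    show "(\<Sum>i. \<integral>\<^sup>+ \<omega>. emeasure (point_process N X \<omega>) (A i) \<partial>M) = (\<integral>\<^sup>+ \<omega>. emeasure (point_process N X \<omega>) (\<Union>i. A i) \<partial>M)"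
      by (subst nn_integral_suminf[symmetric]) (auto simp: p meas A')
  qed
  show "B \<in> sets (intensity M N X)"
    unfolding intensity_def using B sets.sigma_sets_eq[of "borel :: (real ^ 'b) measure"] by simp
qed

text \<open>The bilinear product of a complex and a real vector (no conjugation).\<close>

definition cdot :: "complex ^ 'd \<Rightarrow> real ^ 'd \<Rightarrow> complex" where
  "cdot lam x = (\<Sum>k\<in>UNIV. lam $ k * of_real (x $ k))"

definition laplace :: "(real ^ 'd) measure \<Rightarrow> complex ^ 'd \<Rightarrow> complex" where
  "laplace \<mu> lam = (\<integral>x. exp (- cdot lam x) \<partial>\<mu>)"

definition laplace_domain :: "(real ^ 'd) measure \<Rightarrow> (complex ^ 'd) set" where
  "laplace_domain \<mu> =
     {lam. (\<integral>\<^sup>+ x. ennreal (exp (- ((\<chi> k. Re (lam $ k)) \<bullet> x))) \<partial>\<mu>) < \<infinity>}"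

section \<open>The branching random walk\<close>

definition tuples :: "nat list set" where
  "tuples = {u. \<forall>j\<in>set u. 1 \<le> j}"

text \<open>
  The irrelevant positions are masked, so that the assumption below only concerns the
  points of the processes.
\<close>

definition point_data ::
  "(nat list \<Rightarrow> 'w \<Rightarrow> enat) \<Rightarrow> (nat list \<Rightarrow> nat \<Rightarrow> 'w \<Rightarrow> real ^ 'd) \<Rightarrow> nat list \<Rightarrow> 'w
    \<Rightarrow> enat \<times> (nat \<Rightarrow> real ^ 'd)" where
  "point_data N X u \<omega> = (N u \<omega>, \<lambda>j. if j \<in> labels (N u \<omega>) then X u j \<omega> else 0)"

abbreviation point_data_space :: "(enat \<times> (nat \<Rightarrow> real ^ 'd)) measure" where
  "point_data_space \<equiv> count_space UNIV \<Otimes>\<^sub>M (\<Pi>\<^sub>M j\<in>UNIV. borel)"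

text \<open>
  The point processes attached to the tuples are i.i.d.; the process attached to
  \<open>[]\<close> serves as their common prototype.
\<close>

definition iid_point_processes ::
  "'w measure \<Rightarrow> (nat list \<Rightarrow> 'w \<Rightarrow> enat) \<Rightarrow> (nat list \<Rightarrow> nat \<Rightarrow> 'w \<Rightarrow> real ^ 'd) \<Rightarrow> bool" where
  "iid_point_processes M N X \<longleftrightarrow>
     (\<forall>u\<in>tuples. N u \<in> measurable M (count_space UNIV)) \<and>
     (\<forall>u\<in>tuples. \<forall>j. X u j \<in> borel_measurable M) \<and>
     prob_space.indep_vars M (\<lambda>_. point_data_space) (point_data N X) tuples \<and>
     (\<forall>u\<in>tuples. distr M point_data_space (point_data N X u) =
                  distr M point_data_space (point_data N X []))"

primrec generation :: "(nat list \<Rightarrow> 'w \<Rightarrow> enat) \<Rightarrow> nat \<Rightarrow> 'w \<Rightarrow> nat list set" where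
  "generation N 0 \<omega> = {[]}"
| "generation N (Suc n) \<omega> = {u @ [j] | u j. u \<in> generation N n \<omega> \<and> j \<in> labels (N u \<omega>)}"

definition position :: "(nat list \<Rightarrow> nat \<Rightarrow> 'w \<Rightarrow> real ^ 'd) \<Rightarrow> nat list \<Rightarrow> 'w \<Rightarrow> real ^ 'd" where
  "position X u \<omega> = (\<Sum>k<length u. X (take k u) (u ! k) \<omega>)"

definition mean_measure ::
  "'w measure \<Rightarrow> (nat list \<Rightarrow> 'w \<Rightarrow> enat) \<Rightarrow> (nat list \<Rightarrow> nat \<Rightarrow> 'w \<Rightarrow> real ^ 'd)
    \<Rightarrow> (real ^ 'd) measure" where
  "mean_measure M N X = intensity M (N []) (X [])"

definition weight ::
  "'w measure \<Rightarrow> (nat list \<Rightarrow> 'w \<Rightarrow> enat) \<Rightarrow> (nat list \<Rightarrow> nat \<Rightarrow> 'w \<Rightarrow> real ^ 'd)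
    \<Rightarrow> complex ^ 'd \<Rightarrow> nat list \<Rightarrow> 'w \<Rightarrow> complex" where
  "weight M N X lam u \<omega> =
     (if u \<in> generation N (length u) \<omega>
      then exp (- cdot lam (position X u \<omega>)) / laplace (mean_measure M N X) lam ^ length u
      else 0)"

definition additive_martingale ::
  "'w measure \<Rightarrow> (nat list \<Rightarrow> 'w \<Rightarrow> enat) \<Rightarrow> (nat list \<Rightarrow> nat \<Rightarrow> 'w \<Rightarrow> real ^ 'd)
    \<Rightarrow> complex ^ 'd \<Rightarrow> nat \<Rightarrow> 'w \<Rightarrow> complex" where
  "additive_martingale M N X lam n \<omega> = (\<Sum>\<^sub>\<infinity>u\<in>generation N n \<omega>. weight M N X lam u \<omega>)"

section \<open>Convergence in probability\<close>

definition converges_in_probability ::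
  "'w measure \<Rightarrow> (nat \<Rightarrow> 'w \<Rightarrow> 'b::{metric_space, second_countable_topology}) \<Rightarrow> bool" where
  "converges_in_probability M Y \<longleftrightarrow>
     (\<exists>W\<in>borel_measurable M. \<forall>\<epsilon>>0.
        (\<lambda>n. measure M {\<omega>\<in>space M. dist (Y n \<omega>) (W \<omega>) > \<epsilon>}) \<longlonglongrightarrow> 0)"

end

theory Submission
  imports Defs
begin

text \<open>
  Suppose that the martingale converges in probability. Then its increments tend to 0 in
  probability. Given the first \<open>n\<close> generations, the increment is a sum of independent terms
  \<open>L(u) D(u)\<close> over the individuals \<open>u\<close> of generation \<open>n\<close>, where the \<open>D(u)\<close> are copies of \<open>Z\<^sub>1 - 1\<close>.
  A sum of independent terms can only be small if no single symmetrised term is large. With \<open>W\<close>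
  the difference of two independent copies of \<open>Z\<^sub>1\<close> and \<open>h(c) = P(c |W| \<ge> 1)\<close>, this says that
  the mean of \<open>1 - \<Prod> (1 - h |L(u)|)\<close>, the product taken over a generation, tends to 0
  (\<open>prod_char_tendsto_1\<close>, \<open>symm_tail_iter_tendsto_0\<close>). Tails and characteristic functions are compared by
  averaging the latter over Gaussian arguments (\<open>sum_tails_le_integral_char\<close>).

  Restrict the tree to the first \<open>K\<close> children of each individual, which only makes the mean smaller.
  By the branching property the restricted mean is the \<open>n\<close>-th iterate, evaluated at 1, of the operator that
  maps \<open>h\<close> to the mean of \<open>1 - \<Prod> (1 - h (c |L(u)|))\<close> over the first \<open>K\<close> children \<open>u\<close>
  of the root (\<open>integral_survival_offspring\<close>). For small \<open>h\<close> the operator is nearly linear with eigenfunctions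
  \<open>c\<^sup>s\<close> and eigenvalues \<open>f(s)\<close>, the mean of the sum of \<open>|L(u)|\<^sup>s\<close> over the first generation. The
  hypotheses at \<open>\<alpha>\<close> say that the convex function \<open>f\<close> has value 1 and nonpositive slope there; since
  the process is supercritical, it follows that \<open>f(s) > 1\<close> for all \<open>s < \<alpha>\<close>, and that \<open>f\<close>, after a
  truncation which makes all its values finite, is decreasing at \<open>s\<close>
  (\<open>truncated_tilted_means\<close>). Therefore a bump of the form \<open>c\<^sup>s cos(w ln c)\<close> located at small \<open>c\<close>
  travels under the operator to \<open>c = 1\<close>, growing at least like \<open>c\<^sup>s\<close> on its way
  (\<open>bump_subsolution\<close>). If \<open>h(c)\<close> were larger than \<open>c\<^sup>q\<close> with \<open>q < s\<close> for arbitrarily small \<open>c\<close>, the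
  iterates at 1 would not tend to 0 (\<open>offspring_op_iter_not_small\<close>).

  Hence \<open>h(c) \<le> c\<^sup>q\<close> for small \<open>c\<close> and every \<open>q < \<alpha>\<close>. So \<open>W\<close>, and with it \<open>Z\<^sub>1\<close>, has finite moments of
  every positive order below \<open>\<alpha>\<close>, which contradicts the assumption on \<open>|Z\<^sub>1|\<^sup>p\<close>.
\<close>

section \<open>Weighted branching\<close>

abbreviation seq_space :: "(nat \<Rightarrow> complex) measure" where
  "seq_space \<equiv> \<Pi>\<^sub>M j\<in>UNIV. borel"

text \<open>
  Sums over a random generation are handled through the words over a finite alphabet: they form a
  finite deterministic set, and weights of words that do not occur in the tree are zero.
\<close>

definition words :: "nat \<Rightarrow> nat \<Rightarrow> nat list set" where
  "words K n = {u. length u = n \<and> set u \<subseteq> {1..K}}"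

lemma finite_words: "finite (words K n)"
  using finite_lists_length_eq[of "{1..K}" n] by (simp add: words_def conj_commute)

lemma words_subset_tuples: "words K n \<subseteq> tuples"
  by (auto simp: words_def tuples_def)

lemma words_0: "words K 0 = {[]}"
  by (auto simp: words_def)

lemma prod_words_Suc:
  fixes f :: "nat list \<Rightarrow> 'b::comm_monoid_mult"
  shows "(\<Prod>v\<in>words K (Suc n). f v) = (\<Prod>u\<in>words K n. \<Prod>j\<in>{1..K}. f (u @ [j]))"
proof -
  have "words K (Suc n) = (\<lambda>(u, j). u @ [j]) ` (words K n \<times> {1..K})"
  proof (intro set_eqI iffI)
    fix v assume v: "v \<in> words K (Suc n)"
    then have "v = butlast v @ [last v]"
      by (intro append_butlast_last_id[symmetric]) (auto simp: words_def)
    moreover from v have "butlast v \<in> words K n" "last v \<in> {1..K}"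
      by (auto simp: words_def dest: in_set_butlastD) (metis atLeastAtMost_iff in_mono last_in_set length_0_conv nat.distinct(1))+
    ultimately show "v \<in> (\<lambda>(u, j). u @ [j]) ` (words K n \<times> {1..K})"
      by (intro image_eqI[of _ _ "(butlast v, last v)"]) auto
  qed (auto simp: words_def)
  moreover have "inj_on (\<lambda>(u, j). u @ [j]) (words K n \<times> {1..K})"
    by (auto simp: inj_on_def)
  ultimately have "(\<Prod>v\<in>words K (Suc n). f v) = (\<Prod>(u, j)\<in>words K n \<times> {1..K}. f (u @ [j]))"
    by (simp only: prod.reindex) (simp add: comp_def case_prod_beta)
  then show ?thesis
    by (simp add: prod.cartesian_product)
qed

lemma integrable_bounded:
  fixes f :: "'b \<Rightarrow> complex"
  assumes "prob_space N" "f \<in> borel_measurable N" "\<And>x. x \<in> space N \<Longrightarrow> norm (f x) \<le> 1"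
  shows "integrable N f"
proof -
  interpret prob_space N by fact
  show ?thesis using assms by (intro integrable_const_bound[where B=1]) auto
qed

lemma norm_prod_le_1:
  fixes f :: "'i \<Rightarrow> complex"
  assumes "\<And>i. i \<in> I \<Longrightarrow> norm (f i) \<le> 1"
  shows "norm (prod f I) \<le> 1"
  using assms by (simp add: prod_norm[symmetric] prod_le_1)

lemma norm_integral_le_1:
  fixes f :: "'b \<Rightarrow> complex"
  assumes "prob_space N" "\<And>x. norm (f x) \<le> 1"
  shows "norm (integral\<^sup>L N f) \<le> 1"
proof (cases "integrable N f")
  case True
  interpret prob_space N by fact
  have "norm (integral\<^sup>L N f) \<le> (\<integral>x. norm (f x) \<partial>N)" by (rule integral_norm_bound)
  also have "\<dots> \<le> (\<integral>x. 1 \<partial>N)" using True assms by (intro integral_mono) auto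
  finally show ?thesis by (simp add: prob_space)
qed (simp add: not_integrable_integral_eq)

text \<open>
  Only the complex factors passed from a parent to its children matter for the martingale, so the
  positions are forgotten here. A label without a child carries the factor 0, which turns the
  random tree into the support of the weights.
\<close>

locale branching_weights = prob_space M for M :: "'w measure" +
  fixes T :: "nat list \<Rightarrow> 'w \<Rightarrow> nat \<Rightarrow> complex"
  assumes T_indep: "indep_vars (\<lambda>_. seq_space) T tuples"
    and T_law: "u \<in> tuples \<Longrightarrow> distr M seq_space (T u) = distr M seq_space (T [])"
    and T_0: "T u \<omega> 0 = 0"
    and T_finite: "AE \<omega> in M. finite {j. T [] \<omega> j \<noteq> 0}"
begin

definition wt :: "nat list \<Rightarrow> 'w \<Rightarrow> complex" where
  "wt u \<omega> = (\<Prod>k<length u. T (take k u) \<omega> (u ! k))"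

definition law :: "(nat \<Rightarrow> complex) measure" where
  "law = distr M seq_space (T [])"

lemma wt_Nil: "wt [] \<omega> = 1"
  by (simp add: wt_def)

lemma wt_snoc: "wt (u @ [j]) \<omega> = wt u \<omega> * T u \<omega> j"
proof -
  have "wt (u @ [j]) \<omega> = (\<Prod>k<length u. T (take k (u @ [j])) \<omega> ((u @ [j]) ! k)) * T u \<omega> j"
    by (simp add: wt_def)
  also have "(\<Prod>k<length u. T (take k (u @ [j])) \<omega> ((u @ [j]) ! k)) = wt u \<omega>"
    unfolding wt_def by (intro prod.cong) (auto simp: nth_append)
  finally show ?thesis .
qed

lemma Nil_tuples: "[] \<in> tuples"
  by (simp add: tuples_def)

lemma T_measurable: "u \<in> tuples \<Longrightarrow> T u \<in> measurable M seq_space"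
  using T_indep by (auto simp: indep_vars_def2)

lemma T_component_measurable: "u \<in> tuples \<Longrightarrow> (\<lambda>\<omega>. T u \<omega> j) \<in> borel_measurable M"
  using measurable_compose[OF T_measurable measurable_component_singleton[of j UNIV "\<lambda>_. borel"]] by simp

lemma take_tuples: "u \<in> tuples \<Longrightarrow> take k u \<in> tuples"
  by (auto simp: tuples_def dest: in_set_takeD)

lemma wt_measurable: "u \<in> tuples \<Longrightarrow> wt u \<in> borel_measurable M"
  unfolding wt_def[abs_def] by (intro borel_measurable_prod T_component_measurable take_tuples)

sublocale law: prob_space law
  unfolding law_def by (rule prob_space_distr[OF T_measurable[OF Nil_tuples]])

lemma sets_law [measurable_cong, simp]: "sets law = sets seq_space"
  by (simp add: law_def)

lemma space_law [simp]: "space law = UNIV"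
  by (simp add: law_def space_PiM)

text \<open>
  The weights of the words of length \<open>n\<close> are functions of the factors attached to shorter words,
  which are independent of the factors attached to the words of length \<open>n\<close> themselves. Fubini on
  the finite product space therefore integrates out the latter one by one.
\<close>

lemma integral_prod_words_history:
  fixes F :: "complex \<times> (nat \<Rightarrow> complex) \<Rightarrow> complex" and n K :: nat
  assumes F [measurable]: "F \<in> borel_measurable (borel \<Otimes>\<^sub>M seq_space)" and bound: "\<And>a x. norm (F (a, x)) \<le> 1"
  defines "B \<equiv> {v. length v < n \<and> set v \<subseteq> {1..K}}"
  defines "w \<equiv> \<lambda>(u::nat list) (x :: nat list \<Rightarrow> nat \<Rightarrow> complex). \<Prod>k<length u. x (take k u) (u ! k)"
  shows "(\<integral>\<omega>. (\<Prod>u\<in>words K n. F (wt u \<omega>, T u \<omega>)) \<partial>M) =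
         (\<integral>x. (\<Prod>u\<in>words K n. (\<integral>y. F (w u x, y) \<partial>law)) \<partial>PiM B (\<lambda>_. law))"
proof -
  let ?A = "words K n" and ?J = "B \<union> words K n"
  have finB: "finite B"
  proof -
    have "B \<subseteq> (\<Union>i<n. words K i)" by (auto simp: B_def words_def)
    then show ?thesis by (rule finite_subset) (auto intro: finite_words)
  qed
  have disj: "B \<inter> ?A = {}" by (auto simp: B_def words_def)
  have ne: "?J \<noteq> {}" by (cases n) (auto simp: B_def words_def intro: exI[of _ "[]"])
  have JT: "?J \<subseteq> tuples" by (auto simp: B_def words_def tuples_def)
  have takeB: "take k u \<in> B" if "u \<in> ?A" "k < length u" for u k
    using that by (auto simp: B_def words_def dest: in_set_takeD)
  interpret P: product_prob_space "\<lambda>_. law" ?J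
    by unfold_locales
  have "indep_vars (\<lambda>_. seq_space) T ?J" by (rule indep_vars_subset[OF T_indep JT])
  then have "distr M (PiM ?J (\<lambda>_. seq_space)) (\<lambda>\<omega>. \<lambda>i\<in>?J. T i \<omega>) =
      PiM ?J (\<lambda>i. distr M seq_space (T i))"
    by (subst (asm) indep_vars_iff_distr_eq_PiM'[OF ne]) (use JT T_measurable in auto)
  also have "\<dots> = PiM ?J (\<lambda>_. law)"
    by (intro PiM_cong) (use JT in \<open>auto simp: law_def T_law\<close>)
  finally have joint: "distr M (PiM ?J (\<lambda>_. law)) (\<lambda>\<omega>. \<lambda>i\<in>?J. T i \<omega>) = PiM ?J (\<lambda>_. law)"
    by (subst distr_cong[OF refl sets_PiM_cong[OF refl sets_law] refl]) auto
  have comp [measurable]: "(\<lambda>x. x v j) \<in> borel_measurable (PiM I (\<lambda>_. law))" if "v \<in> I" for v j and I :: "nat list set"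
  proof -
    have "(\<lambda>x. x v) \<in> measurable (PiM I (\<lambda>_. law)) law" using that by measurable
    then have "(\<lambda>x. x v) \<in> measurable (PiM I (\<lambda>_. law)) seq_space"
      by (simp add: measurable_cong_sets[OF refl sets_law])
    from measurable_compose[OF this measurable_component_singleton[of j UNIV "\<lambda>_. borel"]] show ?thesis by simp
  qed
  have w_meas: "w u \<in> borel_measurable (PiM I (\<lambda>_. law))" if "u \<in> ?A" "B \<subseteq> I" for u I
    unfolding w_def by (intro borel_measurable_prod comp) (use that takeB in auto)
  have G_meas: "(\<lambda>x. \<Prod>u\<in>?A. F (w u x, x u)) \<in> borel_measurable (PiM ?J (\<lambda>_. law))"
  proof (intro borel_measurable_prod)
    fix u assume u: "u \<in> ?A"
    have [measurable]: "(\<lambda>x. x u) \<in> measurable (PiM ?J (\<lambda>_. law)) law" by (rule measurable_component_singleton) (use u in simp)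
    have [measurable]: "w u \<in> borel_measurable (PiM ?J (\<lambda>_. law))" using w_meas u by blast
    have "(\<lambda>x. (w u x, x u)) \<in> measurable (PiM ?J (\<lambda>_. law)) (borel \<Otimes>\<^sub>M law)" by (rule measurable_Pair) fact+
    then have "(\<lambda>x. (w u x, x u)) \<in> measurable (PiM ?J (\<lambda>_. law)) (borel \<Otimes>\<^sub>M seq_space)"
      by (simp add: measurable_cong_sets[OF refl sets_pair_measure_cong[OF refl sets_law]])
    from measurable_compose[OF this F] show "(\<lambda>x. F (w u x, x u)) \<in> borel_measurable (PiM ?J (\<lambda>_. law))" .
  qed
  have rv: "(\<lambda>\<omega>. \<lambda>i\<in>?J. T i \<omega>) \<in> measurable M (PiM ?J (\<lambda>_. law))"
    by (intro measurable_restrict) (use JT T_measurable in \<open>auto simp: measurable_cong_sets[OF refl sets_law]\<close>)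
  have "(\<integral>\<omega>. (\<Prod>u\<in>?A. F (wt u \<omega>, T u \<omega>)) \<partial>M) =
      (\<integral>\<omega>. (\<Prod>u\<in>?A. F (w u (\<lambda>i\<in>?J. T i \<omega>), (\<lambda>i\<in>?J. T i \<omega>) u)) \<partial>M)"
  proof (intro Bochner_Integration.integral_cong refl prod.cong)
    fix \<omega> u assume u: "u \<in> ?A"
    have "w u (\<lambda>i\<in>?J. T i \<omega>) = wt u \<omega>"
      unfolding w_def wt_def by (intro prod.cong refl) (use takeB[OF u] in auto)
    with u show "F (wt u \<omega>, T u \<omega>) = F (w u (\<lambda>i\<in>?J. T i \<omega>), (\<lambda>i\<in>?J. T i \<omega>) u)" by simp
  qed
  also have "\<dots> = (\<integral>x. (\<Prod>u\<in>?A. F (w u x, x u)) \<partial>distr M (PiM ?J (\<lambda>_. law)) (\<lambda>\<omega>. \<lambda>i\<in>?J. T i \<omega>))"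
    by (rule integral_distr[OF rv G_meas, symmetric])
  also have "\<dots> = (\<integral>x. (\<Prod>u\<in>?A. F (w u x, x u)) \<partial>PiM ?J (\<lambda>_. law))"
    unfolding joint ..
  also have "\<dots> = (\<integral>x. (\<integral>y. (\<Prod>u\<in>?A. F (w u (merge B ?A (x, y)), merge B ?A (x, y) u)) \<partial>PiM ?A (\<lambda>_. law)) \<partial>PiM B (\<lambda>_. law))"
  proof (rule P.product_integral_fold[OF disj finB finite_words])
    show "integrable (PiM ?J (\<lambda>_. law)) (\<lambda>x. \<Prod>u\<in>?A. F (w u x, x u))"
      by (rule integrable_bounded[OF _ G_meas]) (auto intro!: norm_prod_le_1 bound P.P.prob_space_axioms)
  qed
  also have "\<dots> = (\<integral>x. (\<integral>y. (\<Prod>u\<in>?A. F (w u x, y u)) \<partial>PiM ?A (\<lambda>_. law)) \<partial>PiM B (\<lambda>_. law))"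
  proof (intro Bochner_Integration.integral_cong refl prod.cong)
    fix x y :: "nat list \<Rightarrow> nat \<Rightarrow> complex" and u assume u: "u \<in> ?A"
    have "w u (merge B ?A (x, y)) = w u x"
      unfolding w_def by (intro prod.cong refl) (use takeB[OF u] in \<open>auto simp: merge_def\<close>)
    moreover have "merge B ?A (x, y) u = y u" using u disj by (auto simp: merge_def)
    ultimately show "F (w u (merge B ?A (x, y)), merge B ?A (x, y) u) = F (w u x, y u)" by simp
  qed
  also have "\<dots> = (\<integral>x. (\<Prod>u\<in>?A. (\<integral>y. F (w u x, y) \<partial>law)) \<partial>PiM B (\<lambda>_. law))"
  proof (intro Bochner_Integration.integral_cong refl P.product_integral_prod[OF finite_words])
    fix x u
    show "integrable law (\<lambda>y. F (w u x, y))"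
      by (rule integrable_bounded[OF law.prob_space_axioms]) (auto intro: bound)
  qed
  finally show ?thesis .
qed

text \<open>
  This is the branching property in the form in which it is used below: inside a product over a
  generation, the contribution of each individual's own offspring may be replaced by its mean given
  the past. It is applied both to characteristic functions and to survival probabilities. Both
  sides are the integral of the same function of the history, since averaging a second time changes
  nothing.
\<close>

lemma integral_prod_words_average:
  fixes F :: "complex \<times> (nat \<Rightarrow> complex) \<Rightarrow> complex"
  assumes F [measurable]: "F \<in> borel_measurable (borel \<Otimes>\<^sub>M seq_space)" and bound: "\<And>a x. norm (F (a, x)) \<le> 1"
  shows "(\<integral>\<omega>. (\<Prod>u\<in>words K n. F (wt u \<omega>, T u \<omega>)) \<partial>M) =
         (\<integral>\<omega>. (\<Prod>u\<in>words K n. (\<integral>y. F (wt u \<omega>, y) \<partial>law)) \<partial>M)"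
proof -
  let ?F = "\<lambda>(a, x::nat \<Rightarrow> complex). \<integral>y. F (a, y) \<partial>law"
  have "(\<lambda>a. \<integral>y. F (a, y) \<partial>law) \<in> borel_measurable borel" by measurable
  then have [measurable]: "?F \<in> borel_measurable (borel \<Otimes>\<^sub>M seq_space)" by measurable
  have "norm (?F (a, x)) \<le> 1" for a x
    using norm_integral_le_1[OF law.prob_space_axioms, of "\<lambda>y. F (a, y)"] bound by simp
  from integral_prod_words_history[of ?F K n, OF _ this]
  show ?thesis
    by (simp add: integral_prod_words_history[OF F bound] law.prob_space[unfolded space_law])
qed

end

section \<open>A travelling subsolution\<close>

text \<open>
  A quantitative reverse of the union bound: as long as all probabilities are at most \<open>\<eta>\<close>, the
  nonlinear offspring operator below loses only the constant factor \<open>(1 - \<eta>)^K\<close> against its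
  linearisation.
\<close>

lemma one_minus_prod_ge:
  fixes x :: "'i \<Rightarrow> real"
  assumes "finite S" "\<And>j. j \<in> S \<Longrightarrow> 0 \<le> x j" "\<And>j. j \<in> S \<Longrightarrow> x j \<le> \<eta>" "0 \<le> \<eta>" "\<eta> \<le> 1"
  shows "(1 - \<eta>) ^ card S * (\<Sum>j\<in>S. x j) \<le> 1 - (\<Prod>j\<in>S. 1 - x j)"
  using assms(1-3)
proof (induction S rule: finite_induct)
  case (insert i S)
  let ?P = "\<Prod>j\<in>S. 1 - x j" and ?p = "(1 - \<eta>) ^ card S"
  have IH: "?p * (\<Sum>j\<in>S. x j) \<le> 1 - ?P" using insert by auto
  have P: "?p \<le> ?P"
  proof -
    have "(\<Prod>j\<in>S. 1 - \<eta>) \<le> ?P" by (rule prod_mono) (use insert assms(4,5) in auto)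
    then show ?thesis by simp
  qed
  have x: "0 \<le> x i" "0 \<le> (\<Sum>j\<in>S. x j)" using insert by (auto intro: sum_nonneg)
  have "(1 - \<eta>) ^ card (insert i S) * (\<Sum>j\<in>insert i S. x j) \<le> ?p * (x i + (\<Sum>j\<in>S. x j))"
    using insert x assms(4,5) by (simp add: mult_right_mono mult_left_le_one_le mult.assoc)
  also have "\<dots> \<le> ?P * x i + (1 - ?P)"
    using IH mult_right_mono[OF P x(1)] by (simp add: distrib_left)
  also have "\<dots> = 1 - (\<Prod>j\<in>insert i S. 1 - x j)"
    using insert by (simp add: algebra_simps)
  finally show ?case .
qed simp

text \<open>
  The real part of the exponential with exponent \<open>(s + \<i> w) z\<close>, cut off at the first zeros of
  the cosine.
\<close>

definition bump :: "real \<Rightarrow> real \<Rightarrow> real \<Rightarrow> real" where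
  "bump s w z = (if \<bar>w * z\<bar> \<le> pi / 2 then exp (s * z) * cos (w * z) else 0)"

lemma bump_measurable [measurable]: "bump s w \<in> borel_measurable borel"
  unfolding bump_def[abs_def] by measurable

lemma bump_nonneg: "0 \<le> bump s w z"
  unfolding bump_def by (auto intro!: mult_nonneg_nonneg cos_ge_zero)

lemma bump_0: "bump s w 0 = 1"
  by (simp add: bump_def)

lemma bump_le:
  assumes "0 < w" "0 \<le> s" shows "bump s w z \<le> exp (s * (pi / (2 * w)))"
proof (cases "\<bar>w * z\<bar> \<le> pi / 2")
  case True
  then have "z \<le> pi / (2 * w)" using assms by (simp add: field_simps abs_le_iff)
  then have "s * z \<le> s * (pi / (2 * w))" using assms by (intro mult_left_mono)
  then have "exp (s * z) * cos (w * z) \<le> exp (s * (pi / (2 * w))) * 1"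
    using True by (intro mult_mono) (auto intro!: cos_ge_zero)
  then show ?thesis by (simp add: bump_def True)
qed (simp add: bump_def)

lemma bump_eq_0:
  assumes "0 < w" "z < - (pi / (2 * w))" shows "bump s w z = 0"
proof -
  have "w * z < - (pi / 2)" using assms by (simp add: field_simps)
  then show ?thesis by (simp add: bump_def)
qed

text \<open>
  The cut-off only raises the function where the cosine is nonpositive, that is, up to the next zero
  of the cosine on either side. This is why a shift by a bounded displacement is harmless for small
  \<open>w\<close>.
\<close>

lemma bump_ge:
  assumes "\<bar>w * z\<bar> \<le> 3 * pi / 2"
  shows "exp (s * z) * cos (w * z) \<le> bump s w z"
proof (cases "\<bar>w * z\<bar> \<le> pi / 2")
  case False
  have "cos (pi - \<bar>w * z\<bar>) \<ge> 0" using False assms by (intro cos_ge_zero) auto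
  then have "cos \<bar>w * z\<bar> \<le> 0" by (simp add: cos_diff)
  then have "cos (w * z) \<le> 0" by (simp add: cos_abs_real)
  then show ?thesis using False by (simp add: bump_def mult_le_0_iff)
qed (simp add: bump_def)

lemma cos_sin_approx: 
  fixes x :: real
  shows "1 - x\<^sup>2 / 2 \<le> cos x" "x - x\<^sup>2 / 2 \<le> sin x"
proof -
  have *: "cmod (iexp x - (1 + \<i> * x)) \<le> x\<^sup>2 / 2"
    using iexp_approx1[of x 1] by (simp add: power2_eq_square)
  have "\<bar>cos x - 1\<bar> \<le> x\<^sup>2 / 2"
    using order_trans[OF abs_Re_le_cmod *] by (simp add: cis_conv_exp[symmetric])
  then show "1 - x\<^sup>2 / 2 \<le> cos x" by linarith
  have "\<bar>sin x - x\<bar> \<le> x\<^sup>2 / 2"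
    using order_trans[OF abs_Im_le_cmod *] by (simp add: cis_conv_exp[symmetric])
  then show "x - x\<^sup>2 / 2 \<le> sin x" by linarith
qed

text \<open>
  Complex exponentials are eigenfunctions of the linearised operator. With \<open>l\<^sup>s\<close> tilted by the
  frequency \<open>w\<close>, the eigenvalue is \<open>C - \<i> S\<close> where \<open>C\<close> and \<open>S\<close> are the cosine and sine means below;
  writing it as \<open>r\<close> times a unit complex number of argument \<open>- v\<close> shows that the operator moves the
  bump by \<open>a = v / w\<close> to the right and multiplies it by \<open>r e\<^bsup>s a\<^esup>\<close>. As \<open>w\<close> tends to 0, \<open>r\<close> tends
  to the tilted mean, which exceeds 1, and \<open>a\<close> has the sign of the tilted mean displacement.
\<close>

lemma bump_subsolution:
  fixes l :: "'i \<Rightarrow> 'b \<Rightarrow> real"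
  assumes N: "prob_space N" and [measurable]: "\<And>j. l j \<in> borel_measurable N" and J: "finite J"
    and s: "0 < s" and R: "0 < R"
  defines "tr \<equiv> \<lambda>j x. 0 < l j x \<and> \<bar>ln (l j x)\<bar> \<le> R"
  assumes F0: "1 < (\<integral>x. (\<Sum>j\<in>J. if tr j x then l j x powr s else 0) \<partial>N)" (is "1 < ?F0")
    and F1: "0 < (\<integral>x. (\<Sum>j\<in>J. if tr j x then - ln (l j x) * l j x powr s else 0) \<partial>N)" (is "0 < ?F1")
  obtains w a \<kappa> where "0 < w" "0 < a" "exp (s * a) < \<kappa>"
    "\<And>z. \<kappa> * bump s w (z - a) \<le> (\<integral>x. (\<Sum>j\<in>J. if tr j x then bump s w (z + ln (l j x)) else 0) \<partial>N)"
proof -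
  interpret prob_space N by fact
  have meas [measurable]: "Measurable.pred N (tr j)" for j unfolding tr_def by measurable
  have pw: "l j x powr s \<le> exp (s * R)" if "tr j x" for j x
    using that s by (auto simp: tr_def powr_def intro!: mult_left_mono)
  have pw1: "\<bar>l j x powr s * u\<bar> \<le> exp (s * R)" if "tr j x" "\<bar>u\<bar> \<le> 1" for j x u
    using mult_mono[OF pw[OF that(1)] that(2)] by (simp add: abs_mult)
  have bint: "integrable N (\<lambda>x. \<Sum>j\<in>J. if tr j x then f j x else 0)"
    if [measurable]: "\<And>j. f j \<in> borel_measurable N" and b: "\<And>j x. tr j x \<Longrightarrow> \<bar>f j x\<bar> \<le> c" for f :: "'i \<Rightarrow> 'b \<Rightarrow> real" and c
  proof (intro Bochner_Integration.integrable_sum integrable_const_bound[where B = "\<bar>c\<bar>"] AE_I2)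
    fix i x show "norm (if tr i x then f i x else 0) \<le> \<bar>c\<bar>" using b[of i x] by auto
  qed measurable
  define C where "C w = (\<integral>x. (\<Sum>j\<in>J. if tr j x then l j x powr s * cos (w * - ln (l j x)) else 0) \<partial>N)" for w
  define S where "S w = (\<integral>x. (\<Sum>j\<in>J. if tr j x then l j x powr s * sin (w * - ln (l j x)) else 0) \<partial>N)" for w
  have iC: "integrable N (\<lambda>x. \<Sum>j\<in>J. if tr j x then l j x powr s * cos (w * - ln (l j x)) else 0)" for w
    by (rule bint[of _ "exp (s * R)"]) (auto intro!: pw1)
  have iS: "integrable N (\<lambda>x. \<Sum>j\<in>J. if tr j x then l j x powr s * sin (w * - ln (l j x)) else 0)" for w
    by (rule bint[of _ "exp (s * R)"]) (auto intro!: pw1)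
  have i0: "integrable N (\<lambda>x. \<Sum>j\<in>J. if tr j x then l j x powr s else 0)"
    by (rule bint[of _ "exp (s * R)"]) (auto intro!: pw)
  have i1: "integrable N (\<lambda>x. \<Sum>j\<in>J. if tr j x then - ln (l j x) * l j x powr s else 0)"
    by (rule bint[of _ "R * exp (s * R)"]) (use pw R in \<open>auto simp: abs_mult tr_def intro!: mult_mono\<close>)
  have sq: "(w * - ln (l j x))\<^sup>2 \<le> w\<^sup>2 * R\<^sup>2" if "tr j x" for w j x
  proof -
    have "(ln (l j x))\<^sup>2 \<le> R\<^sup>2" using that R power_mono[of "\<bar>ln (l j x)\<bar>" R 2] by (simp add: tr_def)
    then show ?thesis by (simp add: power_mult_distrib mult_left_mono)
  qed
  have C_ge: "?F0 - w\<^sup>2 * R\<^sup>2 / 2 * ?F0 \<le> C w" for w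
  proof -
    have "?F0 - w\<^sup>2 * R\<^sup>2 / 2 * ?F0 = (\<integral>x. (\<Sum>j\<in>J. if tr j x then l j x powr s else 0) - w\<^sup>2 * R\<^sup>2 / 2 * (\<Sum>j\<in>J. if tr j x then l j x powr s else 0) \<partial>N)"
      using i0 by simp
    also have "\<dots> \<le> C w"
      unfolding C_def
    proof (rule integral_mono)
      fix x
      show "(\<Sum>j\<in>J. if tr j x then l j x powr s else 0) - w\<^sup>2 * R\<^sup>2 / 2 * (\<Sum>j\<in>J. if tr j x then l j x powr s else 0)
        \<le> (\<Sum>j\<in>J. if tr j x then l j x powr s * cos (w * - ln (l j x)) else 0)"
        unfolding sum_distrib_left sum_subtractf[symmetric]
      proof (rule sum_mono)
        fix j
        show "(if tr j x then l j x powr s else 0) - w\<^sup>2 * R\<^sup>2 / 2 * (if tr j x then l j x powr s else 0)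
          \<le> (if tr j x then l j x powr s * cos (w * - ln (l j x)) else 0)"
        proof (cases "tr j x")
          case True
          have "1 - w\<^sup>2 * R\<^sup>2 / 2 \<le> cos (w * - ln (l j x))"
            using cos_sin_approx(1)[of "w * - ln (l j x)"] sq[OF True, of w] by linarith
          from mult_left_mono[OF this, of "l j x powr s"] True show ?thesis
            by (simp add: algebra_simps)
        qed simp
      qed
    qed (use i0 iC in auto)
    finally show ?thesis .
  qed
  have S_ge: "w * ?F1 - w\<^sup>2 * R\<^sup>2 / 2 * ?F0 \<le> S w" for w
  proof -
    have "w * ?F1 - w\<^sup>2 * R\<^sup>2 / 2 * ?F0 = (\<integral>x. w * (\<Sum>j\<in>J. if tr j x then - ln (l j x) * l j x powr s else 0) - w\<^sup>2 * R\<^sup>2 / 2 * (\<Sum>j\<in>J. if tr j x then l j x powr s else 0) \<partial>N)"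
      using i0 i1 by simp
    also have "\<dots> \<le> S w"
      unfolding S_def
    proof (rule integral_mono)
      fix x
      show "w * (\<Sum>j\<in>J. if tr j x then - ln (l j x) * l j x powr s else 0) - w\<^sup>2 * R\<^sup>2 / 2 * (\<Sum>j\<in>J. if tr j x then l j x powr s else 0)
        \<le> (\<Sum>j\<in>J. if tr j x then l j x powr s * sin (w * - ln (l j x)) else 0)"
        unfolding sum_distrib_left sum_subtractf[symmetric]
      proof (rule sum_mono)
        fix j
        show "w * (if tr j x then - ln (l j x) * l j x powr s else 0) - w\<^sup>2 * R\<^sup>2 / 2 * (if tr j x then l j x powr s else 0)
          \<le> (if tr j x then l j x powr s * sin (w * - ln (l j x)) else 0)"
        proof (cases "tr j x")
          case True
          have "w * - ln (l j x) - w\<^sup>2 * R\<^sup>2 / 2 \<le> sin (w * - ln (l j x))"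
            using cos_sin_approx(2)[of "w * - ln (l j x)"] sq[OF True, of w] by linarith
          from mult_left_mono[OF this, of "l j x powr s"] True show ?thesis
            by (simp add: algebra_simps)
        qed simp
      qed
    qed (use i0 i1 iS in auto)
    finally show ?thesis .
  qed
  have "((\<lambda>w. ?F0 - w\<^sup>2 * R\<^sup>2 / 2 * ?F0) \<longlongrightarrow> ?F0 - 0\<^sup>2 * R\<^sup>2 / 2 * ?F0) (at_right 0)"
    by (intro tendsto_intros) simp_all
  then have ev1: "\<forall>\<^sub>F w in at_right 0. 1 < ?F0 - w\<^sup>2 * R\<^sup>2 / 2 * ?F0"
    by (rule order_tendstoD) (use F0 in simp)
  have "((\<lambda>w. ?F1 - w * R\<^sup>2 / 2 * ?F0) \<longlongrightarrow> ?F1 - 0 * R\<^sup>2 / 2 * ?F0) (at_right 0)"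
    by (intro tendsto_intros) simp_all
  then have ev2: "\<forall>\<^sub>F w in at_right 0. 0 < ?F1 - w * R\<^sup>2 / 2 * ?F0"
    by (rule order_tendstoD) (use F1 in simp)
  have "((\<lambda>w. w * R) \<longlongrightarrow> 0 * R) (at_right 0)"
    by (intro tendsto_intros)
  then have ev3: "\<forall>\<^sub>F w in at_right 0. w * R < pi / 2"
    by (rule order_tendstoD) simp
  have ev4: "\<forall>\<^sub>F w in at_right (0::real). 0 < w" by (simp add: eventually_at_right_less)
  \<comment> \<open>The last condition keeps the shifts within the range of the lower bound for the bump.\<close>
  obtain w where w: "0 < w" "1 < ?F0 - w\<^sup>2 * R\<^sup>2 / 2 * ?F0" "0 < ?F1 - w * R\<^sup>2 / 2 * ?F0" "w * R < pi / 2"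
    using eventually_happens[OF eventually_conj[OF ev4 eventually_conj[OF ev1 eventually_conj[OF ev2 ev3]]]]
    by (auto simp: trivial_limit_at_right_real)
  have C1: "1 < C w" using w(2) C_ge[of w] by linarith
  have S0: "0 < S w"
  proof -
    have "0 < w * (?F1 - w * R\<^sup>2 / 2 * ?F0)" using w by (intro mult_pos_pos) auto
    also have "\<dots> = w * ?F1 - w\<^sup>2 * R\<^sup>2 / 2 * ?F0" by (simp add: algebra_simps power2_eq_square)
    finally show ?thesis using S_ge[of w] by linarith
  qed
  define r where "r = sqrt ((C w)\<^sup>2 + (S w)\<^sup>2)"
  define v where "v = arctan (S w / C w)"
  have r1: "1 < r"
  proof -
    have "1 < sqrt ((C w)\<^sup>2)" using C1 by simp
    also have "\<dots> \<le> r" unfolding r_def by (intro real_sqrt_le_mono) simp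
    finally show ?thesis .
  qed
  have v: "0 < v" "v < pi / 2" using C1 S0 arctan_ubound[of "S w / C w"] by (auto simp: v_def)
  have rC: "r / C w = sqrt (1 + (S w / C w)\<^sup>2)"
    using C1 by (simp add: r_def real_sqrt_divide[symmetric] power_divide field_simps)
       (simp add: real_sqrt_divide)
  have cv: "r * cos v = C w" and sv: "r * sin v = S w"
  proof -
    have "cos v = C w / r" using rC r1 C1 unfolding v_def cos_arctan by (metis inverse_eq_divide inverse_divide)
    then show "r * cos v = C w" using r1 by simp
    have "sin v = S w / C w / (r / C w)" unfolding v_def sin_arctan rC ..
    then show "r * sin v = S w" using r1 C1 by simp
  qed
  show thesis
  proof (rule that[of w "v / w" "r * exp (s * (v / w))"])
    show "0 < w" by (fact w(1))
    show "0 < v / w" using v w by simp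
    show "exp (s * (v / w)) < r * exp (s * (v / w))" using r1 by simp
    fix z
    let ?I = "\<integral>x. (\<Sum>j\<in>J. if tr j x then bump s w (z + ln (l j x)) else 0) \<partial>N"
    show "r * exp (s * (v / w)) * bump s w (z - v / w) \<le> ?I"
    proof (cases "\<bar>w * (z - v / w)\<bar> \<le> pi / 2")
      case False
      have "0 \<le> ?I" by (intro integral_nonneg_AE AE_I2 sum_nonneg) (auto simp: bump_nonneg)
      with False show ?thesis by (simp add: bump_def)
    next
      case True
      then have wz: "\<bar>w * z - v\<bar> \<le> pi / 2" using w(1) by (simp add: algebra_simps)
      have "r * exp (s * (v / w)) * bump s w (z - v / w) = exp (s * z) * (r * cos (w * z - v))"
        using True w(1) by (simp add: bump_def right_diff_distrib exp_diff)
      also have "r * cos (w * z - v) = cos (w * z) * C w + sin (w * z) * S w"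
        by (simp add: cos_diff cv[symmetric] sv[symmetric] algebra_simps)
      also have "exp (s * z) * (cos (w * z) * C w + sin (w * z) * S w) =
          (\<integral>x. exp (s * z) * (cos (w * z) * (\<Sum>j\<in>J. if tr j x then l j x powr s * cos (w * - ln (l j x)) else 0)
            + sin (w * z) * (\<Sum>j\<in>J. if tr j x then l j x powr s * sin (w * - ln (l j x)) else 0)) \<partial>N)"
        unfolding C_def S_def using iC[of w] iS[of w] by simp
      also have "\<dots> \<le> ?I"
      proof (rule integral_mono)
        show "integrable N (\<lambda>x. \<Sum>j\<in>J. if tr j x then bump s w (z + ln (l j x)) else 0)"
          by (rule bint[of _ "exp (s * (pi / (2 * w)))"]) (use bump_le[OF w(1)] s bump_nonneg in auto)
        fix x
        show "exp (s * z) * (cos (w * z) * (\<Sum>j\<in>J. if tr j x then l j x powr s * cos (w * - ln (l j x)) else 0)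
            + sin (w * z) * (\<Sum>j\<in>J. if tr j x then l j x powr s * sin (w * - ln (l j x)) else 0))
          \<le> (\<Sum>j\<in>J. if tr j x then bump s w (z + ln (l j x)) else 0)"
          unfolding sum_distrib_left sum.distrib[symmetric]
        proof (rule sum_mono)
          fix j
          show "exp (s * z) * (cos (w * z) * (if tr j x then l j x powr s * cos (w * - ln (l j x)) else 0)
            + sin (w * z) * (if tr j x then l j x powr s * sin (w * - ln (l j x)) else 0))
            \<le> (if tr j x then bump s w (z + ln (l j x)) else 0)"
          proof (cases "tr j x")
            case tr: True
            \<comment> \<open>At most a quarter period from the support, another from \<open>v\<close>, another from the displacement.\<close>
            have "\<bar>w * ln (l j x)\<bar> \<le> w * R" using tr w(1) by (simp add: tr_def abs_mult)
            then have "\<bar>w * (z + ln (l j x))\<bar> \<le> 3 * pi / 2"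
              using wz v w(4) unfolding distrib_left by linarith
            from bump_ge[OF this, of s] tr show ?thesis
              by (simp add: tr_def powr_def distrib_left exp_add cos_add algebra_simps)
          qed simp
        qed
      qed (use iC[of w] iS[of w] in auto)
      finally show ?thesis .
    qed
  qed
qed

section \<open>The offspring operator\<close>

context branching_weights begin

text \<open>
  If \<open>h c\<close> is the probability that an individual of weight \<open>c\<close> produces some exceptional event by
  itself, then \<open>offspring_op K h c\<close> is the probability that one of its first \<open>K\<close> children does.
\<close>

definition offspring_op :: "nat \<Rightarrow> (real \<Rightarrow> real) \<Rightarrow> real \<Rightarrow> real" where
  "offspring_op K h c = (\<integral>x. 1 - (\<Prod>j\<in>{1..K}. 1 - h (c * cmod (x j))) \<partial>law)"

lemma coord_measurable: "(\<lambda>x. x j) \<in> borel_measurable law"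
  using measurable_component_singleton[of j UNIV "\<lambda>_. borel"] by (simp add: measurable_cong_sets[OF sets_law refl])

lemma prod_one_minus_bounds:
  fixes h :: "real \<Rightarrow> real"
  assumes "\<And>c. 0 \<le> h c" "\<And>c. h c \<le> 1"
  shows "0 \<le> (\<Prod>i\<in>I. 1 - h (f i))" "(\<Prod>i\<in>I. 1 - h (f i)) \<le> 1"
  using assms by (auto intro!: prod_nonneg prod_le_1)

lemma integrable_offspring:
  fixes h :: "real \<Rightarrow> real"
  assumes "mono h" "\<And>c. 0 \<le> h c" "\<And>c. h c \<le> 1"
  shows "integrable law (\<lambda>x. 1 - (\<Prod>j\<in>{1..K}. 1 - h (c * cmod (x j))))"
proof -
  note coord_measurable [measurable]
  note [measurable] = borel_measurable_mono[OF assms(1)]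
  have "\<bar>1 - (\<Prod>j\<in>{1..K}. 1 - h (c * cmod (x j)))\<bar> \<le> 1" for x
    using prod_one_minus_bounds[where h = h, OF assms(2,3), where I = "{1..K}" and f = "\<lambda>j. c * cmod (x j)"] by auto
  then show ?thesis by (intro law.integrable_const_bound[where B = 1]) auto
qed

lemma offspring_op:
  fixes h :: "real \<Rightarrow> real"
  assumes h: "mono h" "\<And>c. 0 \<le> h c" "\<And>c. h c \<le> 1"
  shows "mono (offspring_op K h)" "0 \<le> offspring_op K h c" "offspring_op K h c \<le> 1"
proof -
  note b = prod_one_minus_bounds[where h = h, OF h(2,3)]
  show "mono (offspring_op K h)"
  proof (rule monoI)
    fix c d :: real assume "c \<le> d"
    then show "offspring_op K h c \<le> offspring_op K h d"
      unfolding offspring_op_def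
      by (intro integral_mono integrable_offspring h diff_left_mono prod_mono conjI monoD[OF h(1)] mult_right_mono) (use h in auto)
  qed
  show "0 \<le> offspring_op K h c"
    unfolding offspring_op_def by (rule integral_nonneg_AE) (auto intro!: AE_I2 b)
  have "offspring_op K h c \<le> (\<integral>x. 1 \<partial>law)"
    unfolding offspring_op_def by (rule integral_mono) (use integrable_offspring[OF h] b in auto)
  then show "offspring_op K h c \<le> 1" by (simp add: law.prob_space[unfolded space_law])
qed

lemma offspring_op_iter:
  fixes h :: "real \<Rightarrow> real"
  assumes h: "mono h" "\<And>c. 0 \<le> h c" "\<And>c. h c \<le> 1"
  shows "mono ((offspring_op K ^^ n) h)" "0 \<le> (offspring_op K ^^ n) h c" "(offspring_op K ^^ n) h c \<le> 1"
proof -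
  have "mono ((offspring_op K ^^ n) h) \<and> (\<forall>c. 0 \<le> (offspring_op K ^^ n) h c \<and> (offspring_op K ^^ n) h c \<le> 1)"
    by (induction n) (use h offspring_op in auto)
  then show "mono ((offspring_op K ^^ n) h)" "0 \<le> (offspring_op K ^^ n) h c" "(offspring_op K ^^ n) h c \<le> 1"
    by auto
qed

text \<open>
  Iterating the operator is the same as going one generation further down, because the children of
  the last generation can be averaged out first.
\<close>

lemma integral_survival_offspring:
  fixes h :: "real \<Rightarrow> real"
  assumes h: "mono h" "\<And>c. 0 \<le> h c" "\<And>c. h c \<le> 1"
  shows "(\<integral>\<omega>. (\<Prod>u\<in>words K n. 1 - h (cmod (wt u \<omega>))) \<partial>M) = 1 - (offspring_op K ^^ n) h 1"
  using h
proof (induction n arbitrary: h)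
  case 0
  then show ?case by (simp add: words_0 wt_Nil prob_space)
next
  case (Suc n)
  note h = Suc.prems
  note [measurable] = borel_measurable_mono[OF h(1)]
  let ?G = "\<lambda>(a, x). (\<Prod>j\<in>{1..K}. 1 - h (cmod a * cmod (x j)))"
  have G: "(\<lambda>ax. complex_of_real (?G ax)) \<in> borel_measurable (borel \<Otimes>\<^sub>M seq_space)" by measurable
  have Gb: "norm (complex_of_real (?G (a, x))) \<le> 1" for a x
    using prod_one_minus_bounds[where h = h, OF h(2,3), where I = "{1..K}" and f = "\<lambda>j. cmod a * cmod (x j)"]
    by (simp only: norm_of_real) auto
  have op: "(\<integral>x. complex_of_real (?G (a, x)) \<partial>law) = complex_of_real (1 - offspring_op K h (cmod a))" for a
  proof -
    have i: "integrable law (\<lambda>x. ?G (a, x))"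
      using Bochner_Integration.integrable_diff[OF _ integrable_offspring[OF h, where K = K and c = "cmod a"], of "\<lambda>_. 1"] by simp
    have "(\<integral>x. complex_of_real (?G (a, x)) \<partial>law) = complex_of_real (\<integral>x. ?G (a, x) \<partial>law)"
      by (rule integral_complex_of_real)
    also have "(\<integral>x. ?G (a, x) \<partial>law) = 1 - offspring_op K h (cmod a)"
      unfolding offspring_op_def using i by (simp add: law.prob_space[unfolded space_law])
    finally show ?thesis .
  qed
  have "complex_of_real (\<integral>\<omega>. (\<Prod>u\<in>words K (Suc n). 1 - h (cmod (wt u \<omega>))) \<partial>M) =
      (\<integral>\<omega>. (\<Prod>u\<in>words K n. complex_of_real (?G (wt u \<omega>, T u \<omega>))) \<partial>M)"
    by (simp add: prod_words_Suc wt_snoc norm_mult flip: integral_complex_of_real of_real_prod)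
  also have "\<dots> = (\<integral>\<omega>. (\<Prod>u\<in>words K n. (\<integral>x. complex_of_real (?G (wt u \<omega>, x)) \<partial>law)) \<partial>M)"
    by (rule integral_prod_words_average[OF G Gb])
  also have "\<dots> = complex_of_real (\<integral>\<omega>. (\<Prod>u\<in>words K n. 1 - offspring_op K h (cmod (wt u \<omega>))) \<partial>M)"
    by (simp only: op flip: integral_complex_of_real of_real_prod)
  also have "\<dots> = complex_of_real (1 - (offspring_op K ^^ n) (offspring_op K h) 1)"
    by (subst Suc.IH) (use offspring_op h in auto)
  finally show ?case by (simp only: of_real_eq_iff funpow_Suc_right comp_def)
qed

lemma offspring_op_ge:
  fixes h :: "real \<Rightarrow> real"
  assumes h: "mono h" "\<And>c. 0 \<le> h c" "\<And>c. h c \<le> 1"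
    and g [measurable]: "g \<in> borel_measurable borel" and g0: "\<And>c. 0 \<le> g c" and g1: "\<And>c. g c \<le> \<eta>" and gh: "\<And>c. g c \<le> h c"
    and \<eta>: "0 \<le> \<eta>" "\<eta> \<le> 1"
    and P [measurable]: "Measurable.pred borel P"
  shows "(1 - \<eta>) ^ K * (\<integral>x. (\<Sum>j\<in>{1..K}. if P (cmod (x j)) then g (c * cmod (x j)) else 0) \<partial>law) \<le> offspring_op K h c"
proof -
  note coord_measurable [measurable]
  have int: "integrable law (\<lambda>x. \<Sum>j\<in>{1..K}. if P (cmod (x j)) then g (c * cmod (x j)) else 0)"
    by (intro Bochner_Integration.integrable_sum law.integrable_const_bound[where B = \<eta>]) (use g0 g1 \<eta> in auto)
  have "(1 - \<eta>) ^ K * (\<integral>x. (\<Sum>j\<in>{1..K}. if P (cmod (x j)) then g (c * cmod (x j)) else 0) \<partial>law) =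
     (\<integral>x. (1 - \<eta>) ^ K * (\<Sum>j\<in>{1..K}. if P (cmod (x j)) then g (c * cmod (x j)) else 0) \<partial>law)" by simp
  also have "\<dots> \<le> offspring_op K h c"
    unfolding offspring_op_def
  proof (rule integral_mono)
    fix x :: "nat \<Rightarrow> complex"
    let ?g = "\<lambda>j::nat. if P (cmod (x j)) then g (c * cmod (x j)) else 0"
    have "(1 - \<eta>) ^ card {1..K} * (\<Sum>j\<in>{1..K}. ?g j) \<le> 1 - (\<Prod>j\<in>{1..K}. 1 - ?g j)"
      by (rule one_minus_prod_ge) (use g0 g1 \<eta> in auto)
    also have "\<dots> \<le> 1 - (\<Prod>j\<in>{1..K}. 1 - h (c * cmod (x j)))"
      by (intro diff_left_mono prod_mono) (use gh g1 \<eta> h in auto)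
    finally show "(1 - \<eta>) ^ K * (\<Sum>j\<in>{1..K}. ?g j) \<le> 1 - (\<Prod>j\<in>{1..K}. 1 - h (c * cmod (x j)))" by simp
  qed (use int integrable_offspring[OF h] in auto)
  finally show ?thesis .
qed

text \<open>
  Growth along the tree. Suppose that \<open>h\<close> has a tail heavier than \<open>c\<^sup>q\<close> at a very small argument
  \<open>e\<^bsup>- t\<^esup>\<close>. Place a small bump there. Each application of the operator moves it by \<open>a\<close> and multiplies
  it by at least \<open>e\<^bsup>s a\<^esup>\<close>, so that after about \<open>t / a\<close> steps it arrives at the argument 1 after
  growth by about \<open>e\<^bsup>s t\<^esup>\<close>. Since \<open>s > q\<close>, the initial height can be chosen below \<open>e\<^bsup>- q t\<^esup>\<close> and
  still yield a final height that does not depend on \<open>t\<close>. The height increases up to the last step,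
  hence the linearisation is valid all the way.
\<close>

lemma offspring_op_iter_not_small:
  fixes K :: nat and R s q :: real
  defines "tr \<equiv> \<lambda>l::real. 0 < l \<and> \<bar>ln l\<bar> \<le> R"
  assumes R: "0 < R" and q: "0 \<le> q" "q < s"
    and F0: "1 < (\<integral>x. (\<Sum>j\<in>{1..K}. if tr (cmod (x j)) then cmod (x j) powr s else 0) \<partial>law)"
    and F1: "0 < (\<integral>x. (\<Sum>j\<in>{1..K}. if tr (cmod (x j)) then - ln (cmod (x j)) * cmod (x j) powr s else 0) \<partial>law)"
    and h: "mono h" "\<And>c. 0 \<le> h c" "\<And>c. h c \<le> 1"
    and large: "\<And>t0. \<exists>t\<ge>t0. exp (- q * t) \<le> h (exp (- t))"
  shows "\<exists>\<delta>>0. \<forall>n0. \<exists>n\<ge>n0. \<delta> \<le> (offspring_op K ^^ n) h 1"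
proof -
  note coord_measurable [measurable]
  have s: "0 < s" using q by simp
  obtain w a \<kappa> where w: "0 < w" and a: "0 < a" and \<kappa>: "exp (s * a) < \<kappa>"
    and sub: "\<And>z. \<kappa> * bump s w (z - a) \<le> (\<integral>x. (\<Sum>j\<in>{1..K}. if tr (cmod (x j)) then bump s w (z + ln (cmod (x j))) else 0) \<partial>law)"
    using bump_subsolution[OF law.prob_space_axioms, of "\<lambda>j x. cmod (x j)" "{1..K}" s R] s R F0 F1
    unfolding tr_def by (auto simp del: atLeastAtMost_iff)
  have [measurable]: "Measurable.pred borel tr" unfolding tr_def by measurable
  have "((\<lambda>\<eta>. (1 - \<eta>) ^ K * \<kappa>) \<longlongrightarrow> (1 - 0) ^ K * \<kappa>) (at_right 0)" by (intro tendsto_intros)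
  then have ev1: "\<forall>\<^sub>F \<eta> in at_right 0. exp (s * a) < (1 - \<eta>) ^ K * \<kappa>" by (rule order_tendstoD) (use \<kappa> in simp)
  have ev2: "\<forall>\<^sub>F \<eta> in at_right (0::real). 0 < \<eta>" by (simp add: eventually_at_right_less)
  have ev3: "\<forall>\<^sub>F \<eta> in at_right (0::real). \<eta> < 1" by (rule eventually_at_right_field[THEN iffD2]) (auto intro: exI[of _ 1])
  obtain \<eta> where \<eta>: "0 < \<eta>" "\<eta> < 1" "exp (s * a) < (1 - \<eta>) ^ K * \<kappa>"
    using eventually_happens[OF eventually_conj[OF ev2 eventually_conj[OF ev3 ev1]]]
    by (auto simp: trivial_limit_at_right_real)
  define W where "W = pi / (2 * w)"
  define B where "B = exp (s * W)"
  have B: "0 < B" "\<And>z. bump s w z \<le> B" using bump_le[OF w, of s] s by (auto simp: B_def W_def)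
  have W: "0 < W" using w by (simp add: W_def)
  show ?thesis
  proof (intro exI[of _ "\<eta> / B"] conjI allI)
    show "0 < \<eta> / B" using \<eta> B by simp
    fix n0 :: nat
    obtain t where t: "max (W + a * real n0) (s * (W + a) / (s - q)) \<le> t" "exp (- q * t) \<le> h (exp (- t))"
      using large by blast
    define n where "n = nat \<lfloor>(t - W) / a\<rfloor>"
    have tn: "real n0 \<le> (t - W) / a" using t a by (simp add: field_simps)
    have n: "real n * a \<le> t - W" "t - W < real n * a + a"
    proof -
      have "0 \<le> (t - W) / a" using tn by (rule order_trans[OF of_nat_0_le_iff])
      then have "real n = of_int \<lfloor>(t - W) / a\<rfloor>" by (simp add: n_def)
      then have "real n \<le> (t - W) / a" "(t - W) / a < real n + 1" by linarith+
      then show "real n * a \<le> t - W" "t - W < real n * a + a" using a by (auto simp: field_simps)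
    qed
    have "n0 \<le> n" using tn by (simp add: n_def le_nat_floor)
    \<comment> \<open>The height is fixed by its value at the final step \<open>n\<close>; \<open>B\<close> bounds the bump.\<close>
    define A where "A k = \<eta> / B * exp (s * a * (real k - real n))" for k
    define g where "g k c = (if 0 < c then A k * bump s w (ln c + t - W - real k * a) else 0)" for k c
    have A0: "0 \<le> A k" for k using \<eta> B by (simp add: A_def)
    have g0: "0 \<le> g k c" for k c by (simp add: g_def A0 bump_nonneg)
    have g1: "g k c \<le> \<eta>" if "k \<le> n" for k c
    proof -
      have "A k \<le> \<eta> / B" unfolding A_def using that \<eta> B a s by (simp add: field_simps mult_le_0_iff)
      then have "A k * bump s w z \<le> \<eta> / B * B" for z
        by (intro mult_mono) (use B \<eta> bump_nonneg in auto)
      then show ?thesis using B \<eta> by (simp add: g_def)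
    qed
    have [measurable]: "g k \<in> borel_measurable borel" for k unfolding g_def[abs_def] by measurable
    note it = offspring_op_iter[OF h]
    have below: "g k c \<le> (offspring_op K ^^ k) h c" if "k \<le> n" for k c
      using that
    proof (induction k arbitrary: c)
      case 0
      show ?case
      proof (cases "0 < c \<and> - W \<le> ln c + t - W")
        case True
        then have "exp (- t) \<le> c" using exp_le_cancel_iff[of "- t" "ln c"] by simp
        have "s * (W + a) \<le> t * (s - q)" using t q by (simp add: field_simps)
        then have "q * t \<le> s * (t - W - a)" by (simp add: algebra_simps)
        also have "\<dots> \<le> s * (real n * a)" using n s by (intro mult_left_mono) auto
        finally have "exp (- (s * a * real n)) \<le> exp (- q * t)" by (simp add: algebra_simps)
        have "g 0 c \<le> A 0 * B" using True by (simp add: g_def A0 B mult_left_mono)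
        also have "\<dots> = \<eta> * exp (- (s * a * real n))" using B by (simp add: A_def)
        also have "\<dots> \<le> 1 * exp (- q * t)" using \<eta> \<open>exp (- (s * a * real n)) \<le> _\<close> by (intro mult_mono) auto
        also have "\<dots> \<le> h (exp (- t))" using t by simp
        also have "\<dots> \<le> h c" by (rule monoD[OF h(1)]) fact
        finally show ?thesis by simp
      next
        case False
        then have "g 0 c = 0" using bump_eq_0[OF w, of "ln c + t - W" s] by (auto simp: g_def W_def)
        then show ?thesis using h by simp
      qed
    next
      case (Suc k)
      show ?case
      proof (cases "0 < c")
        case c: True
        let ?z = "ln c + t - W - real k * a"
        have "g (Suc k) c = A k * exp (s * a) * bump s w (?z - a)"
          using c by (simp add: g_def A_def algebra_simps exp_add exp_diff)
        also have "\<dots> \<le> A k * ((1 - \<eta>) ^ K * \<kappa>) * bump s w (?z - a)"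
          using \<eta> by (intro mult_right_mono mult_left_mono A0 bump_nonneg) auto
        also have "\<dots> = A k * (1 - \<eta>) ^ K * (\<kappa> * bump s w (?z - a))" by simp
        also have "\<dots> \<le> A k * (1 - \<eta>) ^ K * (\<integral>x. (\<Sum>j\<in>{1..K}. if tr (cmod (x j)) then bump s w (?z + ln (cmod (x j))) else 0) \<partial>law)"
          by (intro mult_left_mono sub) (use A0 \<eta> in auto)
        also have "\<dots> = (1 - \<eta>) ^ K * (\<integral>x. A k * (\<Sum>j\<in>{1..K}. if tr (cmod (x j)) then bump s w (?z + ln (cmod (x j))) else 0) \<partial>law)"
          by simp
        also have "(\<lambda>x. A k * (\<Sum>j\<in>{1..K}. if tr (cmod (x j)) then bump s w (?z + ln (cmod (x j))) else 0)) =
            (\<lambda>x::nat\<Rightarrow>complex. \<Sum>j\<in>{1..K}. if tr (cmod (x j)) then g k (c * cmod (x j)) else 0)"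
          unfolding sum_distrib_left
          by (intro ext sum.cong refl) (use c in \<open>auto simp: g_def tr_def ln_mult algebra_simps\<close>)
        also have "(1 - \<eta>) ^ K * (\<integral>x. (\<Sum>j\<in>{1..K}. if tr (cmod (x j)) then g k (c * cmod (x j)) else 0) \<partial>law)
            \<le> offspring_op K ((offspring_op K ^^ k) h) c"
          by (rule offspring_op_ge[OF it]) (use g0 g1 Suc \<eta> in auto)
        finally show ?thesis by simp
      qed (use it(2)[of "Suc k" K c] in \<open>simp add: g_def\<close>)
    qed
    \<comment> \<open>The centre of the final bump lies at most one step to the left of 1, and the iterate is monotone.\<close>
    define c where "c = exp (- (t - W - real n * a))"
    have "\<eta> / B = g n c" by (simp add: g_def c_def A_def bump_0)
    also have "\<dots> \<le> (offspring_op K ^^ n) h c" by (rule below) simp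
    also have "\<dots> \<le> (offspring_op K ^^ n) h 1"
      by (rule monoD[OF it(1)]) (use n in \<open>simp add: c_def\<close>)
    finally show "\<exists>n\<ge>n0. \<eta> / B \<le> (offspring_op K ^^ n) h 1" using \<open>n0 \<le> n\<close> by blast
  qed
qed

end

section \<open>Tails, characteristic functions and moments\<close>

lemma prod_mult_one_plus_sum_le_1:
  fixes y :: "'i \<Rightarrow> real"
  assumes "finite I" "\<And>i. i \<in> I \<Longrightarrow> 0 \<le> y i" "\<And>i. i \<in> I \<Longrightarrow> y i \<le> 1"
  shows "(\<Prod>i\<in>I. y i) * (1 + (\<Sum>i\<in>I. 1 - y i)) \<le> 1"
  using assms
proof (induction I rule: finite_induct)
  case (insert i I)
  let ?P = "\<Prod>i\<in>I. y i" and ?S = "\<Sum>i\<in>I. 1 - y i"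
  have y: "0 \<le> y i" "y i \<le> 1" using insert by auto
  have P: "?P \<le> 1" "0 \<le> ?P" using insert by (auto intro: prod_le_1 prod_nonneg)
  have "(\<Prod>j\<in>insert i I. y j) * (1 + (\<Sum>j\<in>insert i I. 1 - y j)) = y i * (?P * (1 + ?S)) + (?P * y i) * (1 - y i)"
    using insert by (simp add: algebra_simps)
  also have "\<dots> \<le> y i * 1 + 1 * (1 - y i)"
  proof (rule add_mono)
    show "y i * (?P * (1 + ?S)) \<le> y i * 1" using insert y by (intro mult_left_mono) auto
    show "?P * y i * (1 - y i) \<le> 1 * (1 - y i)" using y P by (intro mult_right_mono mult_le_one) auto
  qed
  finally show ?case by simp
qed simp

lemma one_minus_prod_le_sum:
  fixes x :: "'i \<Rightarrow> real"
  assumes "finite I" "\<And>i. i \<in> I \<Longrightarrow> 0 \<le> x i" "\<And>i. i \<in> I \<Longrightarrow> x i \<le> 1"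
  shows "1 - (\<Prod>i\<in>I. 1 - x i) \<le> (\<Sum>i\<in>I. x i)"
  using assms
proof (induction I rule: finite_induct)
  case (insert i I)
  have "(\<Prod>i\<in>I. 1 - x i) \<le> 1" using insert by (intro prod_le_1) auto
  then have "x i * (\<Prod>i\<in>I. 1 - x i) \<le> x i * 1" using insert by (intro mult_left_mono) auto
  then show ?case using insert by (simp add: algebra_simps)
qed simp

lemma integral_cos_std_normal: "(\<integral>t. cos (t * x) \<partial>std_normal_distribution) = exp (- x\<^sup>2 / 2)"
proof -
  have "complex_of_real (exp (- x\<^sup>2 / 2)) = (\<integral>t. iexp (x * t) \<partial>std_normal_distribution)"
    using char_std_normal_distribution by (metis char_def)
  then have "exp (- x\<^sup>2 / 2) = Re (\<integral>t. iexp (x * t) \<partial>std_normal_distribution)"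
    by (metis Re_complex_of_real)
  also have "\<dots> = (\<integral>t. Re (iexp (x * t)) \<partial>std_normal_distribution)"
    by (rule integral_Re[symmetric]) (rule prob_space.integrable_iexp, auto intro: prob_space_normal_density)
  finally show ?thesis by (simp add: cis_conv_exp[symmetric] mult.commute del: of_real_mult)
qed

text \<open>
  The product on the right is the characteristic function of the sum of independent copies of the
  \<open>X i\<close>. If it is close to 1 for most \<open>t\<close>, then, at these \<open>t\<close>, the sum of the deviations of the
  single characteristic functions from 1 is small; averaging over a Gaussian \<open>t\<close> turns each deviation into a
  bound for a tail probability. The few bad \<open>t\<close> cost at most twice their Gaussian mass in each
  summand, which is absorbed by the constant.
\<close>

lemma sum_tails_le_integral_char:
  fixes X :: "'i \<Rightarrow> 'b \<Rightarrow> real"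
  assumes N: "prob_space N" and I: "finite I" and X [measurable]: "\<And>i. X i \<in> borel_measurable N"
  defines "\<psi> \<equiv> \<lambda>i t. (\<integral>w. cos (t * X i w) \<partial>N)"
  assumes \<psi>: "\<And>i t. 0 \<le> \<psi> i t"
  shows "min 1 (\<Sum>i\<in>I. measure N {w\<in>space N. 1 / 2 \<le> \<bar>X i w\<bar>}) \<le>
    8 / (1 - exp (- 1 / 8)) * (\<integral>t. 1 - (\<Prod>i\<in>I. \<psi> i t) \<partial>std_normal_distribution)"
proof -
  define G where "G = std_normal_distribution"
  interpret N: prob_space N by fact
  interpret G: real_distribution G unfolding G_def by (rule real_dist_normal_dist)
  interpret pair_sigma_finite G N ..
  define c :: real where "c = 1 - exp (- 1 / 8)"
  have c: "0 < c" by (simp add: c_def)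
  have \<psi>_meas [measurable]: "\<psi> i \<in> borel_measurable borel" for i
  proof -
    have "(\<lambda>t. \<integral>w. cos (t * X i w) \<partial>N) \<in> borel_measurable borel" by measurable
    then show ?thesis by (simp add: \<psi>_def)
  qed
  have \<psi>1: "\<psi> i t \<le> 1" for i t
  proof -
    have "\<psi> i t \<le> (\<integral>w. 1 \<partial>N)" unfolding \<psi>_def
      by (intro integral_mono N.integrable_const_bound[where B = 1]) auto
    then show ?thesis by (simp add: N.prob_space)
  qed
  define P where "P t = (\<Prod>i\<in>I. \<psi> i t)" for t
  have [measurable]: "P \<in> borel_measurable borel" unfolding P_def[abs_def] by measurable
  have P: "0 \<le> P t" "P t \<le> 1" for t using \<psi> \<psi>1 by (auto simp: P_def intro: prod_nonneg prod_le_1)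
  define e where "e = (\<integral>t. 1 - P t \<partial>G)"
  have iP: "integrable G (\<lambda>t. 1 - P t)"
    by (rule G.integrable_const_bound[where B = 1]) (use P in \<open>auto simp: G_def\<close>)
  have e0: "0 \<le> e" unfolding e_def by (intro integral_nonneg_AE AE_I2) (use P in auto)
  \<comment> \<open>By Markov, the bad arguments have mass at most \<open>2 * e\<close>.\<close>
  define bad where "bad t = (P t < 1 / 2)" for t
  have [measurable]: "Measurable.pred borel bad" unfolding bad_def by measurable
  have bad_e: "(\<integral>t. of_bool (bad t) \<partial>G) \<le> 2 * e"
  proof -
    have "(\<integral>t. of_bool (bad t) \<partial>G) \<le> (\<integral>t. 2 * (1 - P t) \<partial>G)"
      by (intro integral_mono G.integrable_const_bound[where B = 1] integrable_mult_right iP)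
        (use P in \<open>auto simp: bad_def G_def of_bool_def\<close>)
    then show ?thesis unfolding e_def integral_mult_right_zero .
  qed
  have icos: "integrable G (\<lambda>t. cos (t * x))" for x
    by (rule G.integrable_const_bound[where B = 1]) (auto simp: G_def)
  have ibad: "integrable G (\<lambda>t. of_bool (bad t) :: real)"
    by (rule G.integrable_const_bound[where B = 1]) (auto simp: G_def)
  have iXI: "integrable G (\<lambda>t. of_bool (\<not> bad t) * (1 - cos (t * x)))" for x :: real
    by (rule G.integrable_const_bound[where B = 2]) (use cos_ge_minus_one in \<open>auto simp: G_def of_bool_def abs_le_iff\<close>)
  have i\<psi>: "integrable G (\<lambda>t. of_bool (\<not> bad t) * (1 - \<psi> i t))" for i
    by (rule G.integrable_const_bound[where B = 1]) (use \<psi> \<psi>1 in \<open>auto simp: G_def of_bool_def\<close>)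
  have good: "c - 4 * e \<le> (\<integral>t. of_bool (\<not> bad t) * (1 - cos (t * x)) \<partial>G)" if "1 / 2 \<le> \<bar>x\<bar>" for x
  proof -
    have "(1 / 2)\<^sup>2 \<le> \<bar>x\<bar>\<^sup>2" using that by (intro power_mono) auto
    then have "exp (- x\<^sup>2 / 2) \<le> exp (- 1 / 8)" by (simp add: power2_eq_square)
    then have "c - 4 * e \<le> (1 - exp (- x\<^sup>2 / 2)) - 2 * (\<integral>t. of_bool (bad t) \<partial>G)"
      using bad_e unfolding c_def by linarith
    also have "\<dots> = (\<integral>t. (1 - cos (t * x)) - 2 * of_bool (bad t) \<partial>G)"
    proof -
      have "(\<integral>t. cos (t * x) \<partial>G) = exp (- x\<^sup>2 / 2)"
        unfolding G_def by (rule integral_cos_std_normal)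
      then show ?thesis using G.prob_space icos ibad by simp
    qed
    also have "\<dots> \<le> (\<integral>t. of_bool (\<not> bad t) * (1 - cos (t * x)) \<partial>G)"
    proof (rule integral_mono[OF _ iXI])
      show "integrable G (\<lambda>t. (1 - cos (t * x)) - 2 * of_bool (bad t))"
        using icos ibad by simp
      show "(1 - cos (t * x)) - 2 * of_bool (bad t) \<le> of_bool (\<not> bad t) * (1 - cos (t * x))" for t
        using cos_ge_minus_one[of "t * x"] by (auto simp: of_bool_def)
    qed
    finally show ?thesis .
  qed
  show ?thesis
  proof (cases "e \<le> c / 8")
    case False
    then have "1 \<le> 8 / c * e" using c by (simp add: field_simps)
    then have "min 1 (\<Sum>i\<in>I. measure N {w\<in>space N. 1 / 2 \<le> \<bar>X i w\<bar>}) \<le> 8 / c * e"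
      by (rule min.coboundedI1)
    then show ?thesis unfolding c_def e_def P_def G_def .
  next
    case True
    then have c4: "c / 2 \<le> c - 4 * e" by simp
    have each: "c / 2 * measure N {w\<in>space N. 1 / 2 \<le> \<bar>X i w\<bar>} \<le> (\<integral>t. of_bool (\<not> bad t) * (1 - \<psi> i t) \<partial>G)" for i
    proof -
      have iGN: "integrable (G \<Otimes>\<^sub>M N) (\<lambda>(t, w). of_bool (\<not> bad t) * (1 - cos (t * X i w)))"
      proof -
        interpret GN: prob_space "G \<Otimes>\<^sub>M N" by (rule prob_space_pair) unfold_locales
        have [measurable]: "(\<lambda>(t, w). of_bool (\<not> bad t) * (1 - cos (t * X i w))) \<in> borel_measurable (borel \<Otimes>\<^sub>M N)"
          by measurable
        have meas: "(\<lambda>(t, w). of_bool (\<not> bad t) * (1 - cos (t * X i w))) \<in> borel_measurable (G \<Otimes>\<^sub>M N)"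
          by (simp add: measurable_cong_sets[OF sets_pair_measure_cong[OF G.events_eq_borel refl] refl])
        have "norm (of_bool (\<not> bad t) * (1 - cos y)) \<le> 2" for t y :: real
          using cos_ge_minus_one[of y] cos_le_one[of y] by (cases "bad t") (simp_all add: abs_le_iff)
        then show ?thesis
          using meas
          by (intro GN.integrable_const_bound[where B = 2] AE_I2) (simp_all only: case_prod_beta)
      qed
      have "c / 2 * measure N {w\<in>space N. 1 / 2 \<le> \<bar>X i w\<bar>} = (\<integral>w. c / 2 * indicator {w\<in>space N. 1 / 2 \<le> \<bar>X i w\<bar>} w \<partial>N)"
        by simp
      also have "\<dots> \<le> (\<integral>w. (\<integral>t. of_bool (\<not> bad t) * (1 - cos (t * X i w)) \<partial>G) \<partial>N)"
      proof (rule integral_mono)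
        have "{w\<in>space N. 1 / 2 \<le> \<bar>X i w\<bar>} \<in> sets N" by measurable
        then show "integrable N (\<lambda>w. c / 2 * indicator {w\<in>space N. 1 / 2 \<le> \<bar>X i w\<bar>} w)"
          by (intro integrable_mult_right integrable_real_indicator) (simp_all add: N.emeasure_eq_measure)
        show "integrable N (\<lambda>w. \<integral>t. of_bool (\<not> bad t) * (1 - cos (t * X i w)) \<partial>G)"
          using integrable_snd[OF iGN] by simp
        fix w
        have "0 \<le> (\<integral>t. of_bool (\<not> bad t) * (1 - cos (t * X i w)) \<partial>G)"
          by (intro integral_nonneg_AE AE_I2) auto
        then show "c / 2 * indicator {w\<in>space N. 1 / 2 \<le> \<bar>X i w\<bar>} w \<le> (\<integral>t. of_bool (\<not> bad t) * (1 - cos (t * X i w)) \<partial>G)"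
          using good[of "X i w"] c4 by (auto simp: indicator_def)
      qed
      also have "\<dots> = (\<integral>t. (\<integral>w. of_bool (\<not> bad t) * (1 - cos (t * X i w)) \<partial>N) \<partial>G)"
        by (rule Fubini_integral[OF iGN])
      also have "\<dots> = (\<integral>t. of_bool (\<not> bad t) * (1 - \<psi> i t) \<partial>G)"
      proof (intro Bochner_Integration.integral_cong refl)
        fix t
        have "integrable N (\<lambda>w. cos (t * X i w))" by (rule N.integrable_const_bound[where B = 1]) auto
        then show "(\<integral>w. of_bool (\<not> bad t) * (1 - cos (t * X i w)) \<partial>N) = of_bool (\<not> bad t) * (1 - \<psi> i t)"
          by (simp add: \<psi>_def N.prob_space)
      qed
      finally show ?thesis .
    qed
    have "c / 2 * (\<Sum>i\<in>I. measure N {w\<in>space N. 1 / 2 \<le> \<bar>X i w\<bar>}) \<le> (\<Sum>i\<in>I. (\<integral>t. of_bool (\<not> bad t) * (1 - \<psi> i t) \<partial>G))"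
      unfolding sum_distrib_left by (intro sum_mono each)
    also have "\<dots> = (\<integral>t. (\<Sum>i\<in>I. of_bool (\<not> bad t) * (1 - \<psi> i t)) \<partial>G)"
      using i\<psi> by simp
    also have "\<dots> \<le> (\<integral>t. 2 * (1 - P t) \<partial>G)"
    proof (rule integral_mono)
      fix t
      show "(\<Sum>i\<in>I. of_bool (\<not> bad t) * (1 - \<psi> i t)) \<le> 2 * (1 - P t)"
      proof (cases "bad t")
        case True then show ?thesis using P by simp
      next
        case False
        let ?S = "\<Sum>i\<in>I. 1 - \<psi> i t"
        have "P t * (1 + ?S) \<le> 1" unfolding P_def
          by (rule prod_mult_one_plus_sum_le_1) (use I \<psi> \<psi>1 in auto)
        moreover have "0 \<le> ?S" using \<psi>1 by (intro sum_nonneg) auto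
        then have "1 / 2 * ?S \<le> P t * ?S" using False by (intro mult_right_mono) (auto simp: bad_def)
        ultimately show ?thesis using False by (simp add: algebra_simps)
      qed
    qed (intro Bochner_Integration.integrable_sum integrable_mult_right i\<psi> iP)+
    also have "\<dots> = 2 * e" unfolding e_def by (rule integral_mult_right_zero)
    finally have "(\<Sum>i\<in>I. measure N {w\<in>space N. 1 / 2 \<le> \<bar>X i w\<bar>}) \<le> 4 / c * e" using c by (simp add: field_simps)
    also have "\<dots> \<le> 8 / c * e" using c e0 by (intro mult_right_mono divide_right_mono) auto
    finally show ?thesis by (simp add: c_def e_def P_def G_def)
  qed
qed

text \<open>
  Layers of exponential width: \<open>X\<^sup>p\<close> is at most \<open>e\<^bsup>p (k + 1)\<^esup>\<close> on the layer where \<open>X\<close> lies between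
  \<open>e\<^sup>k\<close> and \<open>e\<^bsup>k + 1\<^esup>\<close>, and the contributions of the layers decay geometrically as \<open>p < q\<close>.
\<close>

lemma moment_finite_of_tail:
  fixes X :: "'b \<Rightarrow> real"
  assumes N: "prob_space N" and X [measurable]: "X \<in> borel_measurable N" and X0: "\<And>w. 0 \<le> X w"
    and p: "0 < p" "p < q"
    and tail: "\<And>t. t0 \<le> t \<Longrightarrow> measure N {w\<in>space N. exp t \<le> X w} \<le> exp (- q * t)"
  shows "(\<integral>\<^sup>+ w. ennreal (X w powr p) \<partial>N) < \<infinity>"
proof -
  interpret prob_space N by fact
  define C where "C = exp (q * \<bar>t0\<bar>)"
  have tailC: "measure N {w\<in>space N. exp (real k) \<le> X w} \<le> C * exp (- q * real k)" for k
  proof (cases "t0 \<le> real k")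
    case True
    have "1 \<le> C" using p by (simp add: C_def)
    from mult_right_mono[OF this, of "exp (- q * real k)"] order_trans[OF tail[OF True]] show ?thesis by simp
  next
    case False
    have "q * real k \<le> q * \<bar>t0\<bar>" using False p by (intro mult_left_mono) auto
    then have "1 \<le> C * exp (- q * real k)" by (simp add: C_def mult_exp_exp)
    then show ?thesis using prob_le_1 order_trans by blast
  qed
  have pt: "ennreal (X w powr p) \<le> 1 + (\<Sum>k. ennreal (exp (p * (real k + 1))) * indicator {w\<in>space N. exp (real k) \<le> X w} w)"
    if w: "w \<in> space N" for w
  proof (cases "1 \<le> X w")
    case True
    define k where "k = nat \<lfloor>ln (X w)\<rfloor>"
    have "0 \<le> ln (X w)" using True by simp
    then have k: "real k \<le> ln (X w)" "ln (X w) < real k + 1" unfolding k_def by linarith+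
    have "X w powr p = exp (p * ln (X w))" using True by (simp add: powr_def)
    also have "\<dots> \<le> exp (p * (real k + 1))" using k p by simp
    finally have "ennreal (X w powr p) \<le> ennreal (exp (p * (real k + 1)))" by (rule ennreal_leI)
    also have "\<dots> = ennreal (exp (p * (real k + 1))) * indicator {w\<in>space N. exp (real k) \<le> X w} w"
    proof -
      have "exp (real k) \<le> X w" using k True by (subst ln_ge_iff[symmetric]) auto
      then show ?thesis using w by simp
    qed
    also have "\<dots> \<le> (\<Sum>k. ennreal (exp (p * (real k + 1))) * indicator {w\<in>space N. exp (real k) \<le> X w} w)"
      (is "?f k \<le> suminf ?f")
    proof -
      have "sum ?f {k} \<le> suminf ?f" by (rule sum_le_suminf) auto
      moreover have "sum ?f {k} = ?f k" by (subst sum.insert) (auto simp only: sum.empty add_0_right finite.emptyI empty_iff)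
      ultimately show ?thesis by (simp only:)
    qed
    finally show ?thesis by (simp add: add_increasing)
  next
    case False
    then have "X w powr p \<le> 1" using X0[of w] p powr_mono2[of p "X w" 1] by simp
    then have "ennreal (X w powr p) \<le> 1" by simp
    then show ?thesis by (rule order_trans) simp
  qed
  have "(\<integral>\<^sup>+ w. ennreal (X w powr p) \<partial>N) \<le> (\<integral>\<^sup>+ w. 1 + (\<Sum>k. ennreal (exp (p * (real k + 1))) * indicator {w\<in>space N. exp (real k) \<le> X w} w) \<partial>N)"
    by (rule nn_integral_mono) (rule pt)
  also have "\<dots> = 1 + (\<Sum>k. ennreal (exp (p * (real k + 1))) * emeasure N {w\<in>space N. exp (real k) \<le> X w})"
    by (subst nn_integral_add) (auto simp: emeasure_space_1 nn_integral_suminf nn_integral_cmult)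
  also have "\<dots> \<le> 1 + (\<Sum>k. ennreal (C * exp p * exp (p - q) ^ k))"
  proof (intro add_left_mono suminf_le summableI)
    fix k
    have "ennreal (exp (p * (real k + 1))) * emeasure N {w\<in>space N. exp (real k) \<le> X w}
      = ennreal (exp (p * (real k + 1)) * measure N {w\<in>space N. exp (real k) \<le> X w})"
      by (simp add: emeasure_eq_measure ennreal_mult)
    also have "\<dots> \<le> ennreal (exp (p * (real k + 1)) * (C * exp (- q * real k)))"
      by (intro ennreal_leI mult_left_mono tailC) simp
    also have "exp (p * (real k + 1)) * (C * exp (- q * real k)) = C * exp p * exp (p - q) ^ k"
    proof -
      have "exp (p * (real k + 1)) * (C * exp (- q * real k)) = C * exp (p * (real k + 1) + - q * real k)"
        by (simp only: exp_add mult_ac)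
      also have "p * (real k + 1) + - q * real k = p + real k * (p - q)" by (simp add: algebra_simps)
      also have "C * exp (p + real k * (p - q)) = C * exp p * exp (p - q) ^ k"
        by (simp add: exp_add exp_of_nat_mult)
      finally show ?thesis .
    qed
    finally show "ennreal (exp (p * (real k + 1))) * emeasure N {w\<in>space N. exp (real k) \<le> X w} \<le> ennreal (C * exp p * exp (p - q) ^ k)" .
  qed
  also have "\<dots> < \<infinity>"
  proof -
    have "summable (\<lambda>k. C * exp p * exp (p - q) ^ k)"
      using p by (intro summable_mult summable_geometric) auto
    then have "(\<Sum>k. ennreal (C * exp p * exp (p - q) ^ k)) = ennreal (\<Sum>k. C * exp p * exp (p - q) ^ k)"
      by (intro suminf_ennreal2) (auto simp: C_def)
    then show ?thesis by simp
  qed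
  finally show ?thesis .
qed

section \<open>The symmetrised child sum\<close>

lemma prod_superset_le:
  fixes f :: "'i \<Rightarrow> real"
  assumes "finite B" "A \<subseteq> B" "\<And>i. 0 \<le> f i" "\<And>i. f i \<le> 1"
  shows "prod f B \<le> prod f A"
proof -
  have "prod f B = prod f (B - A) * prod f A" by (rule prod.subset_diff) fact+
  also have "\<dots> \<le> 1 * prod f A"
    using assms by (intro mult_right_mono prod_le_1 prod_nonneg) auto
  finally show ?thesis by simp
qed

context branching_weights begin

text \<open>
  The complex plane is identified with the real plane by the pairing \<open>Re (z * w)\<close>; in this pairing
  a factor \<open>a\<close> on the random variable becomes a factor \<open>a\<close> on the argument of the characteristic
  function.
\<close>

definition child_sum_char :: "complex \<Rightarrow> complex" where
  "child_sum_char z = (\<integral>x. iexp (Re (z * suminf x)) \<partial>law)"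

text \<open>
  Symmetrisation makes the characteristic function nonnegative and removes the centring by 1: the
  difference of two independent copies is the same for the child sum and for the child sum minus 1.
\<close>

definition symm_law :: "complex measure" where
  "symm_law = distr (law \<Otimes>\<^sub>M law) borel (\<lambda>(x, y). suminf x - suminf y)"

lemma suminf_measurable [measurable]: "suminf \<in> borel_measurable law"
proof -
  note coord_measurable [measurable]
  have "(\<lambda>x. \<Sum>j. x j) \<in> borel_measurable law" by measurable
  then show ?thesis by simp
qed

sublocale law_pair: pair_prob_space law law ..

lemma prob_space_symm_law: "prob_space symm_law"
  unfolding symm_law_def by (rule law_pair.P.prob_space_distr) measurable

lemma sets_symm_law [measurable_cong, simp]: "sets symm_law = sets borel"
  by (simp add: symm_law_def)

lemma space_symm_law [simp]: "space symm_law = UNIV"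
  by (simp add: symm_law_def)

lemma child_sum_char_bound: "norm (child_sum_char z) \<le> 1"
  unfolding child_sum_char_def by (rule norm_integral_le_1[OF law.prob_space_axioms]) simp

lemma integral_cos_symm_law: "(\<integral>w. cos (Re (z * w)) \<partial>symm_law) = (cmod (child_sum_char z))\<^sup>2"
proof -
  let ?e = "\<lambda>x. iexp (Re (z * suminf x))"
  have i: "integrable law ?e"
    by (rule integrable_bounded[OF law.prob_space_axioms]) auto
  have cnj_e: "cnj (?e x) = iexp (- Re (z * suminf x))" for x
    by (simp only: exp_cnj complex_cnj_mult complex_cnj_i complex_cnj_complex_of_real) (simp add: right_diff_distrib)
  have i2: "integrable (law \<Otimes>\<^sub>M law) (\<lambda>xy. ?e (fst xy) * cnj (?e (snd xy)))"
    unfolding cnj_e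
    by (rule integrable_bounded[OF law_pair.P.prob_space_axioms]) (measurable, simp add: norm_mult)
  have "(\<integral>w. iexp (Re (z * w)) \<partial>symm_law) = (\<integral>xy. ?e (fst xy) * cnj (?e (snd xy)) \<partial>(law \<Otimes>\<^sub>M law))"
    unfolding symm_law_def cnj_e
    by (subst integral_distr) (auto intro!: Bochner_Integration.integral_cong simp: case_prod_beta mult_exp_exp algebra_simps)
  also have "\<dots> = (\<integral>x. (\<integral>y. ?e x * cnj (?e y) \<partial>law) \<partial>law)"
    using law_pair.integral_fst'[OF i2] by simp
  also have "\<dots> = child_sum_char z * cnj (child_sum_char z)"
    using i by (simp add: child_sum_char_def)
  also have "\<dots> = complex_of_real ((cmod (child_sum_char z))\<^sup>2)"
    by (rule complex_norm_square[symmetric])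
  finally have *: "(\<integral>w. iexp (Re (z * w)) \<partial>symm_law) = complex_of_real ((cmod (child_sum_char z))\<^sup>2)" .
  have "integrable symm_law (\<lambda>w. iexp (Re (z * w)))"
    by (rule integrable_bounded[OF prob_space_symm_law]) auto
  from integral_Re[OF this] have "(\<integral>w. Re (iexp (Re (z * w))) \<partial>symm_law) = (cmod (child_sum_char z))\<^sup>2"
    unfolding * by (simp only: Re_complex_of_real)
  moreover have "Re (iexp r) = cos r" for r :: real by (simp add: cis_conv_exp[symmetric])
  ultimately show ?thesis by (simp only:)
qed

lemma child_sum_char_measurable [measurable]: "child_sum_char \<in> borel_measurable borel"
  unfolding child_sum_char_def[abs_def] by measurable

definition symm_tail :: "real \<Rightarrow> real" where
  "symm_tail c = measure symm_law {w. 1 \<le> c * cmod w}"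

lemma symm_tail: "mono symm_tail" "0 \<le> symm_tail c" "symm_tail c \<le> 1"
proof -
  interpret S: prob_space symm_law by (rule prob_space_symm_law)
  show "mono symm_tail"
  proof (rule monoI)
    fix c d :: real assume "c \<le> d"
    then have "c * cmod w \<le> d * cmod w" for w by (intro mult_right_mono) auto
    then have "{w. 1 \<le> c * cmod w} \<subseteq> {w. 1 \<le> d * cmod w}"
      by (auto intro: order_trans)
    then show "symm_tail c \<le> symm_tail d"
      unfolding symm_tail_def by (intro S.finite_measure_mono) auto
  qed
qed (auto simp: symm_tail_def prob_space.prob_le_1[OF prob_space_symm_law])

text \<open>
  A complex number of modulus at least 1 has real or imaginary part of modulus at least \<open>1 / 2\<close>.
  Hence two real directions suffice for the one-dimensional estimate.
\<close>

lemma prod_one_minus_symm_tail: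
  assumes I: "finite I"
  shows "1 - (\<Prod>i\<in>I. 1 - symm_tail (cmod (a i))) \<le> 8 / (1 - exp (- 1 / 8)) *
    ((\<integral>t. 1 - (\<Prod>i\<in>I. (cmod (child_sum_char (complex_of_real t * a i)))\<^sup>2) \<partial>std_normal_distribution) +
     (\<integral>t. 1 - (\<Prod>i\<in>I. (cmod (child_sum_char (complex_of_real t * \<i> * a i)))\<^sup>2) \<partial>std_normal_distribution))"
    (is "_ \<le> ?C * (?I1 + ?I2)")
proof -
  interpret S: prob_space symm_law by (rule prob_space_symm_law)
  let ?P = "\<lambda>b i. measure symm_law {w\<in>space symm_law. 1 / 2 \<le> \<bar>Re (b * a i * w)\<bar>}"
  have tail: "symm_tail (cmod (a i)) \<le> ?P 1 i + ?P \<i> i" for i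
  proof -
    have "{w. 1 \<le> cmod (a i) * cmod w} \<subseteq> {w\<in>space symm_law. 1 / 2 \<le> \<bar>Re (1 * a i * w)\<bar>} \<union> {w\<in>space symm_law. 1 / 2 \<le> \<bar>Re (\<i> * a i * w)\<bar>}"
    proof
      fix w assume "w \<in> {w. 1 \<le> cmod (a i) * cmod w}"
      then have "1 \<le> cmod (a i * w)" by (simp add: norm_mult)
      also have "\<dots> \<le> \<bar>Re (a i * w)\<bar> + \<bar>Im (a i * w)\<bar>" by (rule cmod_le)
      finally have "1 / 2 \<le> \<bar>Re (a i * w)\<bar> \<or> 1 / 2 \<le> \<bar>Im (a i * w)\<bar>" by linarith
      moreover have "Re (\<i> * a i * w) = - Im (a i * w)" by (simp add: mult.assoc)
      ultimately show "w \<in> {w\<in>space symm_law. 1 / 2 \<le> \<bar>Re (1 * a i * w)\<bar>} \<union> {w\<in>space symm_law. 1 / 2 \<le> \<bar>Re (\<i> * a i * w)\<bar>}"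
        by (simp del: times_complex.sel)
    qed
    then have "symm_tail (cmod (a i)) \<le> measure symm_law ({w\<in>space symm_law. 1 / 2 \<le> \<bar>Re (1 * a i * w)\<bar>} \<union> {w\<in>space symm_law. 1 / 2 \<le> \<bar>Re (\<i> * a i * w)\<bar>})"
      unfolding symm_tail_def by (intro S.finite_measure_mono) auto
    also have "\<dots> \<le> ?P 1 i + ?P \<i> i" by (intro measure_Un_le) auto
    finally show ?thesis .
  qed
  have char: "(\<integral>w. cos (t * Re (b * a i * w)) \<partial>symm_law) = (cmod (child_sum_char (complex_of_real t * b * a i)))\<^sup>2" for t b i
  proof -
    have "t * Re (b * a i * w) = Re (complex_of_real t * b * a i * w)" for w
      by (simp add: algebra_simps)
    then show ?thesis by (simp only: integral_cos_symm_law)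
  qed
  have one: "min 1 (\<Sum>i\<in>I. ?P b i) \<le> ?C * (\<integral>t. 1 - (\<Prod>i\<in>I. (cmod (child_sum_char (complex_of_real t * b * a i)))\<^sup>2) \<partial>std_normal_distribution)" for b
  proof -
    have "min 1 (\<Sum>i\<in>I. ?P b i) \<le> ?C * (\<integral>t. 1 - (\<Prod>i\<in>I. (\<integral>w. cos (t * Re (b * a i * w)) \<partial>symm_law)) \<partial>std_normal_distribution)"
    proof (rule sum_tails_le_integral_char[OF prob_space_symm_law I])
      have "(\<lambda>w. Re (k * w)) \<in> borel_measurable symm_law" for k :: complex by measurable
      then show "(\<lambda>w. Re (b * a i * w)) \<in> borel_measurable symm_law" for i .
      show "0 \<le> (\<integral>w. cos (t * Re (b * a i * w)) \<partial>symm_law)" for i t unfolding char by simp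
    qed
    then show ?thesis unfolding char .
  qed
  have "1 - (\<Prod>i\<in>I. 1 - symm_tail (cmod (a i))) \<le> min 1 (\<Sum>i\<in>I. symm_tail (cmod (a i)))"
  proof -
    have "(\<Prod>i\<in>I. 1 - symm_tail (cmod (a i))) \<ge> 0" by (intro prod_nonneg) (simp add: symm_tail)
    moreover have "1 - (\<Prod>i\<in>I. 1 - symm_tail (cmod (a i))) \<le> (\<Sum>i\<in>I. symm_tail (cmod (a i)))"
      by (rule one_minus_prod_le_sum) (simp_all add: I symm_tail)
    ultimately show ?thesis by auto
  qed
  also have "\<dots> \<le> min 1 ((\<Sum>i\<in>I. ?P 1 i) + (\<Sum>i\<in>I. ?P \<i> i))"
    unfolding sum.distrib[symmetric] by (intro min.mono order_refl sum_mono tail)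
  also have "\<dots> \<le> min 1 (\<Sum>i\<in>I. ?P 1 i) + min 1 (\<Sum>i\<in>I. ?P \<i> i)"
  proof -
    have "0 \<le> (\<Sum>i\<in>I. ?P b i)" for b by (intro sum_nonneg) simp
    from this[of 1] this[of \<i>] show ?thesis by (auto simp: min_def)
  qed
  also have "\<dots> \<le> ?C * ?I1 + ?C * ?I2" using one[of 1] one[of \<i>] by (intro add_mono) simp_all
  finally show ?thesis by (simp only: distrib_left)
qed

text \<open>
  Given the past, the increment is a sum of independent weighted copies of the child sum minus 1,
  so its characteristic function is the mean of a product over the generation. The centring only
  contributes phases. Factors have modulus at most 1, and dropping those outside a fixed finite
  alphabet can only increase the product of the moduli.
\<close>

lemma prod_char_tendsto_1:
  assumes Y [measurable]: "\<And>n. Y n \<in> borel_measurable M"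
    and lim: "\<And>n. AE \<omega> in M. (\<lambda>m. \<Sum>u\<in>words m n. wt u \<omega> * (suminf (T u \<omega>) - 1)) \<longlonglongrightarrow> Y n \<omega>"
    and Y0: "\<And>\<epsilon>. 0 < \<epsilon> \<Longrightarrow> (\<lambda>n. measure M {\<omega>\<in>space M. \<epsilon> < cmod (Y n \<omega>)}) \<longlonglongrightarrow> 0"
  shows "(\<lambda>n. \<integral>\<omega>. (\<Prod>u\<in>words K n. cmod (child_sum_char (z * wt u \<omega>))) \<partial>M) \<longlonglongrightarrow> 1"
proof -
  let ?E = "\<lambda>n. \<integral>\<omega>. (\<Prod>u\<in>words K n. cmod (child_sum_char (z * wt u \<omega>))) \<partial>M"
  let ?Q = "\<lambda>n. \<integral>\<omega>. iexp (Re (z * Y n \<omega>)) \<partial>M"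
  have [measurable]: "(\<lambda>\<omega>. \<Sum>u\<in>words m n. wt u \<omega> * (suminf (T u \<omega>) - 1)) \<in> borel_measurable M" for m n
  proof -
    have "T u \<in> measurable M law" if "u \<in> words m n" for u
      using T_measurable words_subset_tuples that by (auto simp: measurable_cong_sets[OF refl sets_law])
    from measurable_compose[OF this suminf_measurable] show ?thesis
      using wt_measurable[OF subsetD[OF words_subset_tuples]]
      by (intro borel_measurable_sum borel_measurable_times borel_measurable_diff) auto
  qed
  have wt_m: "wt u \<in> borel_measurable M" if "u \<in> words m n" for u m n
    using that wt_measurable words_subset_tuples by blast
  have int_prod: "integrable M (\<lambda>\<omega>. \<Prod>u\<in>words K n. cmod (child_sum_char (z * wt u \<omega>)))" for n
  proof (rule integrable_const_bound[where B = 1])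
    show "AE \<omega> in M. norm (\<Prod>u\<in>words K n. cmod (child_sum_char (z * wt u \<omega>))) \<le> 1"
      by (intro AE_I2) (auto intro!: prod_le_1 child_sum_char_bound simp: abs_prod)
    have [measurable]: "(\<lambda>\<omega>. child_sum_char (z * wt u \<omega>)) \<in> borel_measurable M" if "u \<in> words K n" for u
      by (rule measurable_compose[OF _ child_sum_char_measurable]) (use wt_m[OF that] in measurable)
    then show "(\<lambda>\<omega>. \<Prod>u\<in>words K n. cmod (child_sum_char (z * wt u \<omega>))) \<in> borel_measurable M"
      by (intro borel_measurable_prod) auto
  qed
  have Q_le: "cmod (?Q n) \<le> ?E n" for n
  proof -
    let ?S = "\<lambda>m \<omega>. \<Sum>u\<in>words m n. wt u \<omega> * (suminf (T u \<omega>) - 1)"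
    have "(\<lambda>m. \<integral>\<omega>. iexp (Re (z * ?S m \<omega>)) \<partial>M) \<longlonglongrightarrow> ?Q n"
    proof (rule integral_dominated_convergence[where w = "\<lambda>_. 1"])
      show "AE \<omega> in M. (\<lambda>m. iexp (Re (z * ?S m \<omega>))) \<longlonglongrightarrow> iexp (Re (z * Y n \<omega>))"
        using lim[of n] by eventually_elim (intro tendsto_intros)
      have "(\<lambda>\<omega>. Re (z * ?S m \<omega>)) \<in> borel_measurable M" for m by measurable
      then show "(\<lambda>\<omega>. iexp (Re (z * ?S m \<omega>))) \<in> borel_measurable M" for m by measurable
    qed (auto intro!: AE_I2)
    moreover have "cmod (\<integral>\<omega>. iexp (Re (z * ?S m \<omega>)) \<partial>M) \<le> ?E n" if "K \<le> m" for m
    proof -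
      let ?F = "\<lambda>(a, x). iexp (Re (z * (a * (suminf x - 1))))"
      have F: "?F \<in> borel_measurable (borel \<Otimes>\<^sub>M seq_space)" by measurable
      have Fbar: "(\<integral>x. ?F (a, x) \<partial>law) = iexp (- Re (z * a)) * child_sum_char (z * a)" for a
        unfolding child_sum_char_def integral_mult_right_zero[symmetric]
        by (intro Bochner_Integration.integral_cong refl) (simp add: mult_exp_exp algebra_simps)
      have "(\<integral>\<omega>. iexp (Re (z * ?S m \<omega>)) \<partial>M) = (\<integral>\<omega>. (\<Prod>u\<in>words m n. ?F (wt u \<omega>, T u \<omega>)) \<partial>M)"
      proof (rule Bochner_Integration.integral_cong[OF refl])
        fix \<omega>
        have "(\<Prod>u\<in>words m n. ?F (wt u \<omega>, T u \<omega>)) = exp (\<Sum>u\<in>words m n. \<i> * complex_of_real (Re (z * (wt u \<omega> * (suminf (T u \<omega>) - 1)))))"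
          by (simp only: exp_sum[OF finite_words] case_prod_conv)
        also have "\<dots> = iexp (\<Sum>u\<in>words m n. Re (z * (wt u \<omega> * (suminf (T u \<omega>) - 1))))"
          by (simp only: of_real_sum sum_distrib_left)
        also have "(\<Sum>u\<in>words m n. Re (z * (wt u \<omega> * (suminf (T u \<omega>) - 1)))) = Re (z * ?S m \<omega>)"
          by (simp only: Re_sum sum_distrib_left)
        finally show "iexp (Re (z * ?S m \<omega>)) = (\<Prod>u\<in>words m n. ?F (wt u \<omega>, T u \<omega>))" ..
      qed
      also have "\<dots> = (\<integral>\<omega>. (\<Prod>u\<in>words m n. (\<integral>x. ?F (wt u \<omega>, x) \<partial>law)) \<partial>M)"
        by (rule integral_prod_words_average[OF F]) simp
      finally have "cmod (\<integral>\<omega>. iexp (Re (z * ?S m \<omega>)) \<partial>M) \<le> (\<integral>\<omega>. cmod (\<Prod>u\<in>words m n. (\<integral>x. ?F (wt u \<omega>, x) \<partial>law)) \<partial>M)"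
        by simp
      also have "\<dots> \<le> ?E n"
      proof (rule integral_mono'[OF int_prod])
        fix \<omega>
        have "words K n \<subseteq> words m n" using that by (force simp: words_def)
        then show "cmod (\<Prod>u\<in>words m n. (\<integral>x. ?F (wt u \<omega>, x) \<partial>law)) \<le> (\<Prod>u\<in>words K n. cmod (child_sum_char (z * wt u \<omega>)))"
          unfolding Fbar prod_norm[symmetric] norm_mult norm_exp_i_times mult_1
          by (rule prod_superset_le[OF finite_words]) (auto intro: child_sum_char_bound)
      qed (auto intro: prod_nonneg)
      finally show ?thesis .
    qed
    then have "\<forall>\<^sub>F m in sequentially. cmod (\<integral>\<omega>. iexp (Re (z * ?S m \<omega>)) \<partial>M) \<le> ?E n"
      by (rule eventually_sequentiallyI)
    ultimately show ?thesis
      by (intro tendsto_upperbound[OF tendsto_norm]) auto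
  qed
  have Q_ge: "1 - (\<epsilon> + 2 * measure M {\<omega>\<in>space M. \<epsilon> / (cmod z + 1) < cmod (Y n \<omega>)}) \<le> cmod (?Q n)" if \<epsilon>: "0 < \<epsilon>" for \<epsilon> n
  proof -
    let ?A = "{\<omega>\<in>space M. \<epsilon> / (cmod z + 1) < cmod (Y n \<omega>)}"
    have iQ: "integrable M (\<lambda>\<omega>. iexp (Re (z * Y n \<omega>)))" by (rule integrable_bounded[OF prob_space_axioms]) auto
    \<comment> \<open>The exponential is Lipschitz where the increment is small and bounded by 2 elsewhere.\<close>
    have "cmod (?Q n - 1) = cmod (\<integral>\<omega>. iexp (Re (z * Y n \<omega>)) - 1 \<partial>M)"
      using iQ by (simp add: prob_space)
    also have "\<dots> \<le> (\<integral>\<omega>. cmod (iexp (Re (z * Y n \<omega>)) - 1) \<partial>M)" by simp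
    also have "\<dots> \<le> (\<integral>\<omega>. \<epsilon> + 2 * indicator ?A \<omega> \<partial>M)"
    proof (rule integral_mono)
      fix \<omega> assume \<omega>: "\<omega> \<in> space M"
      show "cmod (iexp (Re (z * Y n \<omega>)) - 1) \<le> \<epsilon> + 2 * indicator ?A \<omega>"
      proof (cases "\<omega> \<in> ?A")
        case True
        then show ?thesis using \<epsilon> norm_triangle_ineq4[of "iexp (Re (z * Y n \<omega>))" 1] by simp
      next
        case False
        then have "cmod (Y n \<omega>) * (cmod z + 1) \<le> \<epsilon>" using \<omega> \<epsilon>
          by (simp add: field_simps add_pos_nonneg not_less)
        moreover have "cmod (iexp (Re (z * Y n \<omega>)) - 1) \<le> \<bar>Re (z * Y n \<omega>)\<bar>"
          using iexp_approx1[of "Re (z * Y n \<omega>)" 0] by simp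
        moreover have "\<bar>Re (z * Y n \<omega>)\<bar> \<le> cmod (z * Y n \<omega>)" by (rule abs_Re_le_cmod)
        moreover have "cmod (z * Y n \<omega>) \<le> cmod (Y n \<omega>) * (cmod z + 1)" by (simp add: norm_mult algebra_simps)
        ultimately show ?thesis using False by simp
      qed
    qed (use iQ in \<open>auto intro!: integrable_real_mult_indicator\<close>)
    also have "\<dots> = \<epsilon> + 2 * measure M ?A"
    proof -
      have A: "?A \<in> sets M" by measurable
      then have "integrable M (indicator ?A :: _ \<Rightarrow> real)" by (simp add: emeasure_eq_measure)
      with A show ?thesis by (simp add: prob_space)
    qed
    finally show ?thesis using norm_triangle_ineq2[of 1 "1 - ?Q n"] by (simp add: norm_minus_commute)
  qed
  have E1: "?E n \<le> 1" for n
  proof -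
    have "?E n \<le> (\<integral>\<omega>. 1 \<partial>M)"
      by (intro integral_mono int_prod prod_le_1) (auto intro: child_sum_char_bound)
    then show ?thesis by (simp add: prob_space)
  qed
  show ?thesis
  proof (rule tendstoI)
    fix e :: real assume e: "0 < e"
    have "\<forall>\<^sub>F n in sequentially. measure M {\<omega>\<in>space M. e / 2 / (cmod z + 1) < cmod (Y n \<omega>)} < e / 4"
      by (rule order_tendstoD(2)[OF Y0]) (use e in \<open>auto intro!: divide_pos_pos add_nonneg_pos\<close>)
    then show "\<forall>\<^sub>F n in sequentially. dist (?E n) 1 < e"
    proof eventually_elim
      case (elim n)
      have "1 - ?E n < e" using Q_ge[of "e / 2" n] Q_le[of n] elim e by linarith
      with E1[of n] show ?case by (simp add: dist_real_def)
    qed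
  qed
qed

text \<open>
  The products of characteristic functions converge to 1 pointwise in the argument, which gives
  convergence of the Gaussian average in the preceding bound by dominated convergence.
\<close>

lemma symm_tail_iter_tendsto_0:
  assumes char: "\<And>z. (\<lambda>n. \<integral>\<omega>. (\<Prod>u\<in>words K n. cmod (child_sum_char (z * wt u \<omega>))) \<partial>M) \<longlonglongrightarrow> 1"
  shows "(\<lambda>n. (offspring_op K ^^ n) symm_tail 1) \<longlonglongrightarrow> 0"
proof -
  let ?G = "std_normal_distribution"
  let ?p = "\<lambda>b n t \<omega>. \<Prod>u\<in>words K n. (cmod (child_sum_char (complex_of_real t * b * wt u \<omega>)))\<^sup>2"
  interpret G: real_distribution ?G by (rule real_dist_normal_dist)
  interpret GM: pair_prob_space ?G M ..
  have wt_m [measurable]: "wt u \<in> borel_measurable M" if "u \<in> words K n" for u n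
    using that wt_measurable words_subset_tuples by blast
  have p01: "0 \<le> ?p b n t \<omega>" "?p b n t \<omega> \<le> 1" for b n t \<omega>
    by (auto intro!: prod_nonneg prod_le_1 power_le_one child_sum_char_bound)
  have p_meas: "(\<lambda>(t, \<omega>). ?p b n t \<omega>) \<in> borel_measurable (?G \<Otimes>\<^sub>M M)" for b n
  proof -
    have [measurable]: "(\<lambda>(t, \<omega>). child_sum_char (complex_of_real t * b * wt u \<omega>)) \<in> borel_measurable (borel \<Otimes>\<^sub>M M)" if "u \<in> words K n" for u
      using wt_m[OF that] by measurable
    then have "(\<lambda>(t, \<omega>). ?p b n t \<omega>) \<in> borel_measurable (borel \<Otimes>\<^sub>M M)"
      unfolding case_prod_beta by (intro borel_measurable_prod borel_measurable_power borel_measurable_norm) (auto simp: case_prod_beta)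
    then show ?thesis
      by (simp add: measurable_cong_sets[OF sets_pair_measure_cong[OF G.events_eq_borel refl] refl])
  qed
  have int: "integrable (?G \<Otimes>\<^sub>M M) (\<lambda>(t, \<omega>). 1 - ?p b n t \<omega>)" for b n
    by (rule GM.P.integrable_const_bound[where B = 1]) (use p01 p_meas[of b n] in \<open>auto simp: case_prod_beta\<close>)
  have intM: "integrable M (\<lambda>\<omega>. ?p b n t \<omega>)" for b n t
  proof (rule integrable_const_bound[where B = 1])
    show "(\<lambda>\<omega>. ?p b n t \<omega>) \<in> borel_measurable M"
      using measurable_compose[OF measurable_Pair1'[of t ?G M] p_meas[of b n]] by simp
  qed (use p01 in auto)
  let ?e = "\<lambda>b n t. \<integral>\<omega>. 1 - ?p b n t \<omega> \<partial>M"
  have e_lim: "(\<lambda>n. ?e b n t) \<longlonglongrightarrow> 0" for b t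
  proof (rule tendsto_sandwich[of "\<lambda>_. 0" _ _ "\<lambda>n. 2 * (1 - (\<integral>\<omega>. (\<Prod>u\<in>words K n. cmod (child_sum_char (complex_of_real t * b * wt u \<omega>))) \<partial>M))"])
    show "\<forall>\<^sub>F n in sequentially. 0 \<le> ?e b n t"
      by (intro always_eventually allI integral_nonneg_AE AE_I2) (use p01 in auto)
    show "\<forall>\<^sub>F n in sequentially. ?e b n t \<le> 2 * (1 - (\<integral>\<omega>. (\<Prod>u\<in>words K n. cmod (child_sum_char (complex_of_real t * b * wt u \<omega>))) \<partial>M))"
    proof (intro always_eventually allI)
      fix n
      let ?y = "\<lambda>\<omega>. \<Prod>u\<in>words K n. cmod (child_sum_char (complex_of_real t * b * wt u \<omega>))"
      have y: "0 \<le> ?y \<omega>" "?y \<omega> \<le> 1" for \<omega>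
        by (auto intro!: prod_nonneg prod_le_1 child_sum_char_bound)
      have arith: "1 - a \<le> 2 * (1 - c)" if "0 \<le> a - 2 * c + 1" for a c :: real
        using that by simp
      have iy: "integrable M ?y"
      proof (rule integrable_const_bound[where B = 1])
        show "?y \<in> borel_measurable M" by measurable
      qed (use y in auto)
      have "?e b n t \<le> (\<integral>\<omega>. 2 * (1 - ?y \<omega>) \<partial>M)"
      proof (rule integral_mono)
        fix \<omega>
        have "0 \<le> (?y \<omega> - 1)\<^sup>2" by simp
        also have "(?y \<omega> - 1)\<^sup>2 = ?p b n t \<omega> - 2 * ?y \<omega> + 1"
          unfolding prod_power_distrib[symmetric] by (simp add: power2_diff)
        finally show "1 - ?p b n t \<omega> \<le> 2 * (1 - ?y \<omega>)" by (rule arith)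
      qed (use intM iy in auto)
      also have "\<dots> = 2 * (1 - (\<integral>\<omega>. ?y \<omega> \<partial>M))" using iy by (simp add: prob_space)
      finally show "?e b n t \<le> 2 * (1 - (\<integral>\<omega>. ?y \<omega> \<partial>M))" .
    qed
    have "(\<lambda>n. 2 * (1 - (\<integral>\<omega>. (\<Prod>u\<in>words K n. cmod (child_sum_char (complex_of_real t * b * wt u \<omega>))) \<partial>M))) \<longlonglongrightarrow> 2 * (1 - 1)"
      by (intro tendsto_intros char)
    then show "(\<lambda>n. 2 * (1 - (\<integral>\<omega>. (\<Prod>u\<in>words K n. cmod (child_sum_char (complex_of_real t * b * wt u \<omega>))) \<partial>M))) \<longlonglongrightarrow> 0" by simp
  qed auto
  have e_meas: "?e b n \<in> borel_measurable ?G" for b n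
    using GM.integrable_fst'[OF int[of b n]] by auto
  have lim: "(\<lambda>n. \<integral>t. ?e b n t \<partial>?G) \<longlonglongrightarrow> (\<integral>t. 0 \<partial>?G)" for b
  proof (rule integral_dominated_convergence[where w = "\<lambda>_. 1"])
    fix n
    have "norm (?e b n t) \<le> 1" for t
    proof -
      have "0 \<le> ?e b n t" by (intro integral_nonneg_AE AE_I2) (use p01 in auto)
      moreover have "?e b n t \<le> (\<integral>\<omega>. 1 \<partial>M)" by (intro integral_mono) (use intM p01 in auto)
      ultimately show ?thesis by (simp add: prob_space)
    qed
    then show "AE t in ?G. norm (?e b n t) \<le> 1" by simp
  qed (use e_meas e_lim in auto)
  let ?C = "8 / (1 - exp (- 1 / 8)) :: real"
  have upper: "(offspring_op K ^^ n) symm_tail 1 \<le> ?C * ((\<integral>t. ?e 1 n t \<partial>?G) + (\<integral>t. ?e \<i> n t \<partial>?G))" for n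
  proof -
    have swap: "(\<integral>\<omega>. (\<integral>t. 1 - ?p b n t \<omega> \<partial>?G) \<partial>M) = (\<integral>t. ?e b n t \<partial>?G)" for b
      using GM.Fubini_integral[OF int[of b n]] by simp
    have iM: "integrable M (\<lambda>\<omega>. \<integral>t. 1 - ?p b n t \<omega> \<partial>?G)" for b
      using GM.integrable_snd[OF int[of b n]] by simp
    note [measurable] = borel_measurable_mono[OF symm_tail(1)]
    have ih: "integrable M (\<lambda>\<omega>. \<Prod>u\<in>words K n. 1 - symm_tail (cmod (wt u \<omega>)))"
    proof (rule integrable_const_bound[where B = 1])
      have "norm (\<Prod>u\<in>words K n. 1 - symm_tail (cmod (wt u \<omega>))) \<le> 1" for \<omega>
        using prod_one_minus_bounds[where h = symm_tail and I = "words K n" and f = "\<lambda>u. cmod (wt u \<omega>)", OF symm_tail(2,3)]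
        by (simp only: real_norm_def abs_of_nonneg)
      then show "AE \<omega> in M. norm (\<Prod>u\<in>words K n. 1 - symm_tail (cmod (wt u \<omega>))) \<le> 1" by simp
    qed measurable
    have "(offspring_op K ^^ n) symm_tail 1 = (\<integral>\<omega>. 1 - (\<Prod>u\<in>words K n. 1 - symm_tail (cmod (wt u \<omega>))) \<partial>M)"
      using integral_survival_offspring[OF symm_tail, of K n] ih by (simp add: prob_space)
    also have "\<dots> \<le> (\<integral>\<omega>. ?C * ((\<integral>t. 1 - ?p 1 n t \<omega> \<partial>?G) + (\<integral>t. 1 - ?p \<i> n t \<omega> \<partial>?G)) \<partial>M)"
    proof (rule integral_mono)
      show "integrable M (\<lambda>\<omega>. ?C * ((\<integral>t. 1 - ?p 1 n t \<omega> \<partial>?G) + (\<integral>t. 1 - ?p \<i> n t \<omega> \<partial>?G)))"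
        by (intro integrable_mult_right Bochner_Integration.integrable_add iM)
      show "1 - (\<Prod>u\<in>words K n. 1 - symm_tail (cmod (wt u \<omega>))) \<le> ?C * ((\<integral>t. 1 - ?p 1 n t \<omega> \<partial>?G) + (\<integral>t. 1 - ?p \<i> n t \<omega> \<partial>?G))" for \<omega>
        using prod_one_minus_symm_tail[OF finite_words, where a = "\<lambda>u. wt u \<omega>"] by simp
    qed (use ih in auto)
    also have "\<dots> = ?C * ((\<integral>t. ?e 1 n t \<partial>?G) + (\<integral>t. ?e \<i> n t \<partial>?G))"
      unfolding integral_mult_right_zero Bochner_Integration.integral_add[OF iM iM] swap ..
    finally show ?thesis .
  qed
  show ?thesis
  proof (rule tendsto_sandwich[of "\<lambda>_. 0" _ _ "\<lambda>n. ?C * ((\<integral>t. ?e 1 n t \<partial>?G) + (\<integral>t. ?e \<i> n t \<partial>?G))"])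
    have "(\<lambda>n. ?C * ((\<integral>t. ?e 1 n t \<partial>?G) + (\<integral>t. ?e \<i> n t \<partial>?G))) \<longlonglongrightarrow> ?C * ((\<integral>t. 0 \<partial>?G) + (\<integral>t. 0 \<partial>?G))"
      by (intro tendsto_intros lim)
    then show "(\<lambda>n. ?C * ((\<integral>t. ?e 1 n t \<partial>?G) + (\<integral>t. ?e \<i> n t \<partial>?G))) \<longlonglongrightarrow> 0" by simp
  qed (use upper offspring_op_iter(2)[OF symm_tail] in auto)
qed

end

section \<open>First generation means and moments of the child sum\<close>

text \<open>
  The convex function \<open>s \<mapsto> u\<^sup>s\<close> lies above its tangent at \<open>t\<close>.
\<close>

lemma powr_tangent:
  fixes u :: real
  assumes "0 < u"
  shows "u powr t * (1 + (s - t) * ln u) \<le> u powr s"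
proof -
  have "u powr t * (1 + (s - t) * ln u) \<le> u powr t * exp ((s - t) * ln u)"
    by (intro mult_left_mono exp_ge_add_one_self) simp
  also have "\<dots> = u powr s" using assms by (simp add: powr_def mult_exp_exp algebra_simps)
  finally show ?thesis .
qed

lemma powr_tangent_eq:
  fixes u :: real
  assumes "0 < u" "s \<noteq> t" "u powr t * (1 + (s - t) * ln u) = u powr s"
  shows "u = 1"
proof -
  have "u powr s = u powr t * exp ((s - t) * ln u)" using assms(1) by (simp add: powr_def mult_exp_exp algebra_simps)
  then have "exp ((s - t) * ln u) = 1 + (s - t) * ln u" using assms by simp
  then have "ln (exp ((s - t) * ln u)) = exp ((s - t) * ln u) - 1" unfolding ln_exp by linarith
  then have "exp ((s - t) * ln u) = 1" by (intro ln_eq_minus_one) auto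
  then show ?thesis using assms by simp
qed

context branching_weights begin

lemma AE_law: "AE x in law. x 0 = 0 \<and> finite {j. x j \<noteq> 0}"
proof -
  have "AE \<omega> in M. T [] \<omega> 0 = 0 \<and> finite {j. T [] \<omega> j \<noteq> 0}"
    using T_finite by (auto simp: T_0)
  moreover have "{x \<in> space seq_space. x 0 = 0 \<and> finite {j. x j \<noteq> (0::complex)}} \<in> sets seq_space"
  proof -
    have "finite {j. x j \<noteq> (0::complex)} \<longleftrightarrow> (\<exists>k. \<forall>j. k < j \<longrightarrow> x j = 0)" for x :: "nat \<Rightarrow> complex"
    proof
      assume "finite {j. x j \<noteq> 0}"
      then obtain k where "\<forall>j\<in>{j. x j \<noteq> 0}. j \<le> k" unfolding finite_nat_set_iff_bounded_le by blast
      then show "\<exists>k. \<forall>j. k < j \<longrightarrow> x j = 0" by (meson leD mem_Collect_eq)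
    next
      assume "\<exists>k. \<forall>j. k < j \<longrightarrow> x j = 0"
      then obtain k where "\<forall>j. k < j \<longrightarrow> x j = 0" ..
      then have "{j. x j \<noteq> 0} \<subseteq> {..k}" using leI by blast
      then show "finite {j. x j \<noteq> 0}" by (rule finite_subset) simp
    qed
    then have *: "{x \<in> space seq_space. x 0 = 0 \<and> finite {j. x j \<noteq> (0::complex)}} =
        {x \<in> space seq_space. x 0 = 0 \<and> (\<exists>k. \<forall>j. k < j \<longrightarrow> x j = (0::complex))}"
      by simp
    show ?thesis unfolding * by measurable
  qed
  ultimately show ?thesis
    unfolding law_def by (subst AE_distr_iff[OF T_measurable[OF Nil_tuples]]) auto
qed

text \<open>
  Integrating the tangent inequality at \<open>\<alpha>\<close>, where the mean of the powers is 1 and the slope is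
  nonpositive, shows that the mean of the powers is at least 1 for every \<open>s < \<alpha>\<close>. Equality forces
  all nonzero factors to have modulus 1, but then the mean number of children would be 1 as well.
  By monotone convergence the strict inequality survives a truncation to finitely many children
  with bounded displacement. For the truncated factors the mean at \<open>\<alpha>\<close> is at most 1; the tangent
  inequality at \<open>s\<close> now says that the mean must decrease there, which is the second claim.
\<close>

lemma truncated_tilted_means:
  fixes \<alpha> s :: real
  assumes s: "s < \<alpha>"
    and mean_\<alpha>: "(\<integral>\<^sup>+x. (\<Sum>j. ennreal (cmod (x j) powr \<alpha>)) \<partial>law) = 1"
    and log_int: "integrable law (\<lambda>x. \<Sum>j. cmod (x j) powr \<alpha> * ln (cmod (x j)))"
    and log_le: "(\<integral>x. (\<Sum>j. cmod (x j) powr \<alpha> * ln (cmod (x j))) \<partial>law) \<le> 0"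
    and count: "1 < (\<integral>\<^sup>+x. (\<Sum>j. of_bool (x j \<noteq> 0)) \<partial>law)"
  obtains K where "0 < K"
    "1 < (\<integral>x. (\<Sum>j\<in>{1..K}. if 0 < cmod (x j) \<and> \<bar>ln (cmod (x j))\<bar> \<le> real K then cmod (x j) powr s else 0) \<partial>law)"
    "0 < (\<integral>x. (\<Sum>j\<in>{1..K}. if 0 < cmod (x j) \<and> \<bar>ln (cmod (x j))\<bar> \<le> real K
              then - ln (cmod (x j)) * cmod (x j) powr s else 0) \<partial>law)"
proof -
  note coord_measurable [measurable]
  let ?g = "\<lambda>t x. \<Sum>j. ennreal (cmod (x j :: complex) powr t)"
  have fin_sums: "(\<lambda>j. f (x j)) sums (\<Sum>j\<in>{j. x j \<noteq> 0}. f (x j))" if "finite {j. x j \<noteq> 0}" "f 0 = 0"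
    for f :: "complex \<Rightarrow> real" and x :: "nat \<Rightarrow> complex"
    by (rule sums_finite) (use that in auto)
  have g_eq: "?g t x = ennreal (\<Sum>j\<in>{j. x j \<noteq> 0}. cmod (x j) powr t)" "?g t x = ennreal (\<Sum>j. cmod (x j) powr t)"
    if "finite {j. x j \<noteq> 0}" for t x
  proof -
    have *: "(\<lambda>j. cmod (x j) powr t) sums (\<Sum>j\<in>{j. x j \<noteq> 0}. cmod (x j) powr t)"
      using fin_sums[of x "\<lambda>c. cmod c powr t"] that by simp
    show 1: "?g t x = ennreal (\<Sum>j. cmod (x j) powr t)"
      by (rule suminf_ennreal2) (use * in \<open>auto simp: sums_iff\<close>)
    show "?g t x = ennreal (\<Sum>j\<in>{j. x j \<noteq> 0}. cmod (x j) powr t)"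
      unfolding 1 using * by (simp add: sums_iff)
  qed
  have gt1: "1 < (\<integral>\<^sup>+x. ?g s x \<partial>law)"
  proof (rule ccontr)
    assume "\<not> 1 < (\<integral>\<^sup>+x. ?g s x \<partial>law)"
    then have le1: "(\<integral>\<^sup>+x. ?g s x \<partial>law) \<le> 1" by simp
    have int: "integrable law (\<lambda>x. \<Sum>j. cmod (x j) powr t)" "ennreal (\<integral>x. (\<Sum>j. cmod (x j) powr t) \<partial>law) = (\<integral>\<^sup>+x. ?g t x \<partial>law)"
      if "(\<integral>\<^sup>+x. ?g t x \<partial>law) \<le> 1" for t
    proof -
      have pos: "AE x in law. 0 \<le> (\<Sum>j. cmod (x j) powr t)"
        using AE_law
      proof eventually_elim
        case (elim x)
        then have "(\<Sum>j. cmod (x j) powr t) = (\<Sum>j\<in>{j. x j \<noteq> 0}. cmod (x j) powr t)"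
          using fin_sums[of x "\<lambda>c. cmod c powr t"] by (simp add: sums_iff)
        then show ?case by (simp add: sum_nonneg)
      qed
      have eq: "(\<integral>\<^sup>+x. ?g t x \<partial>law) = (\<integral>\<^sup>+x. ennreal (\<Sum>j. cmod (x j) powr t) \<partial>law)"
        by (rule nn_integral_cong_AE, rule AE_mp[OF AE_law], rule AE_I2) (blast intro: g_eq(2))
      show i: "integrable law (\<lambda>x. \<Sum>j. cmod (x j) powr t)"
      proof (rule integrableI_nonneg[OF _ pos])
        show "(\<integral>\<^sup>+x. ennreal (\<Sum>j. cmod (x j) powr t) \<partial>law) < \<infinity>"
          unfolding eq[symmetric] using le_less_trans[OF that ennreal_one_less_top] by simp
      qed measurable
      show "ennreal (\<integral>x. (\<Sum>j. cmod (x j) powr t) \<partial>law) = (\<integral>\<^sup>+x. ?g t x \<partial>law)"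
        unfolding eq by (rule nn_integral_eq_integral[OF i pos, symmetric])
    qed
    note i\<alpha> = int[OF eq_refl[OF mean_\<alpha>]] and is1 = int[OF le1]
    have I\<alpha>: "(\<integral>x. (\<Sum>j. cmod (x j) powr \<alpha>) \<partial>law) = 1" using trans[OF i\<alpha>(2) mean_\<alpha>] by (simp only: ennreal_eq_1)
    have Is: "(\<integral>x. (\<Sum>j. cmod (x j) powr s) \<partial>law) \<le> 1" using ord_eq_le_trans[OF is1(2) le1] by (simp only: ennreal_le_1)
    define Y where "Y x = (\<Sum>j. cmod (x j) powr s) - (\<Sum>j. cmod (x j) powr \<alpha>) - (s - \<alpha>) * (\<Sum>j. cmod (x j) powr \<alpha> * ln (cmod (x j)))" for x :: "nat \<Rightarrow> complex"
    have Y_eq: "Y x = (\<Sum>j\<in>{j. x j \<noteq> 0}. cmod (x j) powr s - cmod (x j) powr \<alpha> * (1 + (s - \<alpha>) * ln (cmod (x j))))"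
      if "finite {j. x j \<noteq> 0}" for x
    proof -
      have "(\<Sum>j. cmod (x j) powr t) = (\<Sum>j\<in>{j. x j \<noteq> 0}. cmod (x j) powr t)" for t
        using fin_sums[OF that, of "\<lambda>c. cmod c powr t"] by (simp add: sums_iff)
      moreover have "(\<Sum>j. cmod (x j) powr \<alpha> * ln (cmod (x j))) = (\<Sum>j\<in>{j. x j \<noteq> 0}. cmod (x j) powr \<alpha> * ln (cmod (x j)))"
        using fin_sums[OF that, of "\<lambda>c. cmod c powr \<alpha> * ln (cmod c)"] by (simp add: sums_iff)
      ultimately show ?thesis
        unfolding Y_def by (simp add: sum_subtractf sum.distrib sum_distrib_left algebra_simps)
    qed
    have gap: "0 \<le> cmod c powr s - cmod c powr \<alpha> * (1 + (s - \<alpha>) * ln (cmod c))" if "c \<noteq> 0" for c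
      using powr_tangent[of "cmod c" \<alpha> s] that by simp
    have Y0: "AE x in law. 0 \<le> Y x"
      using AE_law by eventually_elim (auto simp: Y_eq intro!: sum_nonneg gap)
    have iY: "integrable law Y"
      unfolding Y_def[abs_def] using i\<alpha>(1) is1(1) log_int by simp
    have "(\<integral>x. Y x \<partial>law) = (\<integral>x. (\<Sum>j. cmod (x j) powr s) \<partial>law) - 1 + (\<alpha> - s) * (\<integral>x. (\<Sum>j. cmod (x j) powr \<alpha> * ln (cmod (x j))) \<partial>law)"
      unfolding Y_def[abs_def] using i\<alpha>(1) is1(1) log_int by (simp add: I\<alpha> algebra_simps)
    also have "\<dots> \<le> 0" using Is s mult_nonneg_nonpos[OF _ log_le, of "\<alpha> - s"] by linarith
    finally have "(\<integral>x. Y x \<partial>law) = 0" using integral_nonneg_AE[OF Y0] by simp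
    then have "AE x in law. Y x = 0" using integral_nonneg_eq_0_iff_AE[OF iY Y0] by simp
    with AE_law have "AE x in law. (\<Sum>j. of_bool (x j \<noteq> 0)) = ?g \<alpha> x"
    proof eventually_elim
      case (elim x)
      then have fin: "finite {j. x j \<noteq> 0}" by simp
      have "cmod (x j) = 1" if "x j \<noteq> 0" for j
      proof -
        have "cmod (x j) powr s - cmod (x j) powr \<alpha> * (1 + (s - \<alpha>) * ln (cmod (x j))) = 0"
        proof -
          let ?f = "\<lambda>j. cmod (x j) powr s - cmod (x j) powr \<alpha> * (1 + (s - \<alpha>) * ln (cmod (x j)))"
          have "sum ?f {j. x j \<noteq> 0} = 0" using elim(2) unfolding Y_eq[OF fin] .
          moreover have "0 \<le> ?f j" if "j \<in> {j. x j \<noteq> 0}" for j using gap[of "x j"] that by blast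
          ultimately have "\<forall>j\<in>{j. x j \<noteq> 0}. ?f j = 0" by (subst (asm) sum_nonneg_eq_0_iff[OF fin])
          then show ?thesis using that by blast
        qed
        then show ?thesis using powr_tangent_eq[of "cmod (x j)" s \<alpha>] that s by simp
      qed
      then have "of_bool (x j \<noteq> 0) = ennreal (cmod (x j) powr \<alpha>)" for j by (cases "x j = 0") auto
      then show ?case by simp
    qed
    then have "(\<integral>\<^sup>+x. (\<Sum>j. of_bool (x j \<noteq> 0)) \<partial>law) = (\<integral>\<^sup>+x. ?g \<alpha> x \<partial>law)"
      by (rule nn_integral_cong_AE)
    then show False using count mean_\<alpha> by simp
  qed
  define tr where "tr K c \<longleftrightarrow> 0 < cmod c \<and> \<bar>ln (cmod c)\<bar> \<le> real K" for K c
  have [measurable]: "Measurable.pred borel (tr K)" for K unfolding tr_def[abs_def] by measurable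
  define G where "G t K x = (\<Sum>j\<in>{1..K}. if tr K (x j) then cmod (x j) powr t else 0)" for t K and x :: "nat \<Rightarrow> complex"
  have [measurable]: "G t K \<in> borel_measurable law" for t K unfolding G_def[abs_def] by measurable
  have G0: "0 \<le> G t K x" for t K x unfolding G_def by (intro sum_nonneg) auto
  have bounded: "integrable law (\<lambda>x. \<Sum>j\<in>{1..K}. if tr K (x j) then f (x j) else 0)"
    if [measurable]: "f \<in> borel_measurable borel" and b: "\<And>c. tr K c \<Longrightarrow> \<bar>f c\<bar> \<le> B" for f :: "complex \<Rightarrow> real" and K B
  proof (intro Bochner_Integration.integrable_sum law.integrable_const_bound[where B = "\<bar>B\<bar>"] AE_I2)
    fix j x show "norm (if tr K (x j) then f (x j) else 0) \<le> \<bar>B\<bar>" using b[of "x j"] by auto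
  qed measurable
  have pw: "cmod c powr t \<le> exp (\<bar>t\<bar> * real K)" if "tr K c" for c t K
  proof -
    have "t * ln (cmod c) \<le> \<bar>t\<bar> * \<bar>ln (cmod c)\<bar>" by (simp add: abs_mult[symmetric])
    also have "\<dots> \<le> \<bar>t\<bar> * real K" using that by (intro mult_left_mono) (auto simp: tr_def)
    finally show ?thesis using that by (simp add: powr_def tr_def)
  qed
  have iG: "integrable law (G t K)" for t K
    unfolding G_def[abs_def] by (rule bounded[of _ K "exp (\<bar>t\<bar> * real K)"]) (auto intro: pw)
  have iL: "integrable law (\<lambda>x. \<Sum>j\<in>{1..K}. if tr K (x j) then - ln (cmod (x j)) * cmod (x j) powr t else 0)" for t K
  proof (rule bounded[of _ K "real K * exp (\<bar>t\<bar> * real K)"])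
    fix c assume c: "tr K c"
    then show "\<bar>- ln (cmod c) * cmod c powr t\<bar> \<le> real K * exp (\<bar>t\<bar> * real K)"
      unfolding abs_mult by (intro mult_mono) (use pw[OF c, of t] in \<open>auto simp: tr_def\<close>)
  qed measurable
  have "AE x in law. ?g s x \<le> (SUP K. ennreal (G s K x))"
    using AE_law
  proof eventually_elim
    case (elim x)
    then have fin: "finite {j. x j \<noteq> 0}" by simp
    \<comment> \<open>A finite support has a largest label and a largest displacement, so the truncation is eventually exact.\<close>
    obtain K1 where K1: "\<And>j. x j \<noteq> 0 \<Longrightarrow> j \<le> K1" using fin by (auto simp: finite_nat_set_iff_bounded_le)
    obtain K2 where K2: "\<And>j. x j \<noteq> 0 \<Longrightarrow> nat \<lceil>\<bar>ln (cmod (x j))\<bar>\<rceil> \<le> K2"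
      using fin finite_imageI[OF fin, of "\<lambda>j. nat \<lceil>\<bar>ln (cmod (x j))\<bar>\<rceil>"] by (auto simp: finite_nat_set_iff_bounded_le)
    define K where "K = max K1 K2"
    have tr: "tr K (x j) \<and> j \<in> {1..K}" if "x j \<noteq> 0" for j
    proof -
      have "\<bar>ln (cmod (x j))\<bar> \<le> real K2" using K2[OF that] by linarith
      moreover have "j \<noteq> 0" using elim that by (cases j) auto
      ultimately show ?thesis using K1[OF that] that by (auto simp: tr_def K_def)
    qed
    have "(\<Sum>j\<in>{j. x j \<noteq> 0}. cmod (x j) powr s) = (\<Sum>j\<in>{j. x j \<noteq> 0}. if tr K (x j) then cmod (x j) powr s else 0)"
      by (rule sum.cong) (use tr in auto)
    also have "\<dots> = G s K x"
      unfolding G_def by (rule sum.mono_neutral_left) (use tr in \<open>auto simp: tr_def\<close>)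
    finally have "?g s x = ennreal (G s K x)" using g_eq(1)[OF fin] by simp
    also have "\<dots> \<le> (SUP K. ennreal (G s K x))" by (rule SUP_upper) simp
    finally show ?case .
  qed
  then have "(\<integral>\<^sup>+x. ?g s x \<partial>law) \<le> (\<integral>\<^sup>+x. (SUP K. ennreal (G s K x)) \<partial>law)" by (rule nn_integral_mono_AE)
  also have "\<dots> = (SUP K. \<integral>\<^sup>+x. ennreal (G s K x) \<partial>law)"
  proof (rule nn_integral_monotone_convergence_SUP)
    show "incseq (\<lambda>K x. ennreal (G s K x))"
    proof (intro incseq_SucI le_funI ennreal_leI)
      fix K x
      have "G s K x \<le> (\<Sum>j\<in>{1..K}. if tr (Suc K) (x j) then cmod (x j) powr s else 0)"
        unfolding G_def by (intro sum_mono) (auto simp: tr_def)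
      also have "\<dots> \<le> G s (Suc K) x" unfolding G_def by (intro sum_mono2) auto
      finally show "G s K x \<le> G s (Suc K) x" .
    qed
  qed measurable
  finally have "1 < (SUP K. \<integral>\<^sup>+x. ennreal (G s K x) \<partial>law)" using gt1 by (rule less_le_trans[rotated])
  then obtain K where K: "1 < (\<integral>\<^sup>+x. ennreal (G s K x) \<partial>law)" by (auto simp: less_SUP_iff)
  have F: "(\<integral>\<^sup>+x. ennreal (G t K x) \<partial>law) = ennreal (\<integral>x. G t K x \<partial>law)" for t
    by (rule nn_integral_eq_integral[OF iG]) (simp add: G0)
  have F0: "1 < (\<integral>x. G s K x \<partial>law)" using K unfolding F by (metis ennreal_1 ennreal_less_iff zero_le_one)
  have "(\<integral>\<^sup>+x. ennreal (G \<alpha> K x) \<partial>law) \<le> (\<integral>\<^sup>+x. ?g \<alpha> x \<partial>law)"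
  proof (rule nn_integral_mono)
    fix x
    have "ennreal (G \<alpha> K x) \<le> ennreal (\<Sum>j\<in>{1..K}. cmod (x j) powr \<alpha>)"
      unfolding G_def by (intro ennreal_leI sum_mono) auto
    also have "\<dots> = (\<Sum>j\<in>{1..K}. ennreal (cmod (x j) powr \<alpha>))" by simp
    also have "\<dots> \<le> ?g \<alpha> x" by (rule sum_le_suminf) auto
    finally show "ennreal (G \<alpha> K x) \<le> ?g \<alpha> x" .
  qed
  then have F\<alpha>: "(\<integral>x. G \<alpha> K x \<partial>law) \<le> 1" unfolding F mean_\<alpha> by simp
  let ?L = "\<lambda>x. \<Sum>j\<in>{1..K}. if tr K (x j) then - ln (cmod (x j)) * cmod (x j) powr s else 0"
  have "(\<integral>x. G s K x \<partial>law) - (\<alpha> - s) * (\<integral>x. ?L x \<partial>law) = (\<integral>x. G s K x - (\<alpha> - s) * ?L x \<partial>law)"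
    using iG iL by simp
  also have "\<dots> \<le> (\<integral>x. G \<alpha> K x \<partial>law)"
  proof (rule integral_mono)
    fix x
    show "G s K x - (\<alpha> - s) * ?L x \<le> G \<alpha> K x"
      unfolding G_def sum_distrib_left sum_subtractf[symmetric]
    proof (rule sum_mono)
      fix j
      show "(if tr K (x j) then cmod (x j) powr s else 0) - (\<alpha> - s) * (if tr K (x j) then - ln (cmod (x j)) * cmod (x j) powr s else 0)
        \<le> (if tr K (x j) then cmod (x j) powr \<alpha> else 0)"
        using powr_tangent[of "cmod (x j)" s \<alpha>] by (auto simp: tr_def algebra_simps)
    qed
  qed (use iG iL in auto)
  finally have "0 < (\<alpha> - s) * (\<integral>x. ?L x \<partial>law)" using F0 F\<alpha> by simp
  then have F1: "0 < (\<integral>x. ?L x \<partial>law)" using s by (simp add: zero_less_mult_iff)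
  have "0 < K" using F0 by (cases K) (auto simp: G_def)
  then show thesis using that[of K] F0 F1 unfolding G_def tr_def by blast
qed

text \<open>
  Iterates that vanish at 1 exclude a symmetrised tail above \<open>c\<^sup>q\<close> at arbitrarily small \<open>c\<close>, where
  \<open>q\<close> is chosen between \<open>p\<close> and \<open>\<alpha>\<close>. A moment of the symmetrisation is a moment of the child sum
  shifted by some constant, by Fubini.
\<close>

lemma child_sum_moment_finite:
  assumes iter: "\<And>K. (\<lambda>n. (offspring_op K ^^ n) symm_tail 1) \<longlonglongrightarrow> 0"
    and means: "\<And>s. s < \<alpha> \<Longrightarrow> \<exists>K>0.
      1 < (\<integral>x. (\<Sum>j\<in>{1..K}. if 0 < cmod (x j) \<and> \<bar>ln (cmod (x j))\<bar> \<le> real K then cmod (x j) powr s else 0) \<partial>law) \<and>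
      0 < (\<integral>x. (\<Sum>j\<in>{1..K}. if 0 < cmod (x j) \<and> \<bar>ln (cmod (x j))\<bar> \<le> real K
              then - ln (cmod (x j)) * cmod (x j) powr s else 0) \<partial>law)"
    and p: "0 < p" "p < \<alpha>"
  shows "(\<integral>\<^sup>+x. ennreal (cmod (suminf x) powr p) \<partial>law) < \<infinity>"
proof -
  define q where "q = p + (\<alpha> - p) / 3"
  define s where "s = p + 2 * (\<alpha> - p) / 3"
  have qs: "p < q" "q < s" "s < \<alpha>" using p by (auto simp: q_def s_def field_simps)
  obtain K where K: "0 < K"
    and F0: "1 < (\<integral>x. (\<Sum>j\<in>{1..K}. if 0 < cmod (x j) \<and> \<bar>ln (cmod (x j))\<bar> \<le> real K then cmod (x j) powr s else 0) \<partial>law)"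
    and F1: "0 < (\<integral>x. (\<Sum>j\<in>{1..K}. if 0 < cmod (x j) \<and> \<bar>ln (cmod (x j))\<bar> \<le> real K
              then - ln (cmod (x j)) * cmod (x j) powr s else 0) \<partial>law)"
    using means[OF qs(3)] by blast
  have "\<not> (\<forall>t0. \<exists>t\<ge>t0. exp (- q * t) \<le> symm_tail (exp (- t)))"
  proof
    assume "\<forall>t0. \<exists>t\<ge>t0. exp (- q * t) \<le> symm_tail (exp (- t))"
    then obtain \<delta> where "0 < \<delta>" and \<delta>: "\<And>n0. \<exists>n\<ge>n0. \<delta> \<le> (offspring_op K ^^ n) symm_tail 1"
      using offspring_op_iter_not_small[of "real K" q s K symm_tail, OF _ _ qs(2) F0 F1 symm_tail] p qs K by auto
    have "\<forall>\<^sub>F n in sequentially. (offspring_op K ^^ n) symm_tail 1 < \<delta>"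
      by (rule order_tendstoD(2)[OF iter \<open>0 < \<delta>\<close>])
    then show False using \<delta> unfolding eventually_sequentially by (meson leD)
  qed
  then obtain t0 where "\<forall>t\<ge>t0. \<not> exp (- q * t) \<le> symm_tail (exp (- t))" by blast
  then have t0: "symm_tail (exp (- t)) \<le> exp (- q * t)" if "t0 \<le> t" for t
    using that by (meson linear)
  have "(\<integral>\<^sup>+w. ennreal (cmod w powr p) \<partial>symm_law) < \<infinity>"
  proof (rule moment_finite_of_tail[OF prob_space_symm_law _ _ p(1) qs(1)])
    fix t assume "t0 \<le> t"
    have "exp t \<le> cmod w \<longleftrightarrow> 1 \<le> exp (- t) * cmod w" for w
      by (simp add: exp_minus field_simps)
    then show "measure symm_law {w \<in> space symm_law. exp t \<le> cmod w} \<le> exp (- q * t)"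
      using t0[OF \<open>t0 \<le> t\<close>] by (simp add: symm_tail_def)
  qed auto
  also have "(\<integral>\<^sup>+w. ennreal (cmod w powr p) \<partial>symm_law) = (\<integral>\<^sup>+y. (\<integral>\<^sup>+x. ennreal (cmod (suminf x - suminf y) powr p) \<partial>law) \<partial>law)"
    unfolding symm_law_def
    by (subst nn_integral_distr) (auto simp: case_prod_beta law_pair.nn_integral_snd[symmetric])
  finally have fin: "(\<integral>\<^sup>+y. (\<integral>\<^sup>+x. ennreal (cmod (suminf x - suminf y) powr p) \<partial>law) \<partial>law) \<noteq> \<infinity>" by simp
  have "AE y in law. (\<integral>\<^sup>+x. ennreal (cmod (suminf x - suminf y) powr p) \<partial>law) \<noteq> \<infinity>"
    by (rule nn_integral_PInf_AE[OF _ fin]) measurable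
  then obtain y where y: "(\<integral>\<^sup>+x. ennreal (cmod (suminf x - suminf y) powr p) \<partial>law) \<noteq> \<infinity>"
    using law.AE_False by (metis (mono_tags, lifting) eventually_mono)
  have "(\<integral>\<^sup>+x. ennreal (cmod (suminf x) powr p) \<partial>law) \<le>
      (\<integral>\<^sup>+x. ennreal (2 powr p) * (ennreal (cmod (suminf x - suminf y) powr p) + ennreal (cmod (suminf y) powr p)) \<partial>law)"
  proof (rule nn_integral_mono)
    fix x
    let ?a = "cmod (suminf x - suminf y)" and ?b = "cmod (suminf y)"
    have "cmod (suminf x) \<le> ?a + ?b" using norm_triangle_ineq[of "suminf x - suminf y" "suminf y"] by simp
    also have "\<dots> \<le> 2 * max ?a ?b" by simp
    finally have "cmod (suminf x) powr p \<le> (2 * max ?a ?b) powr p" using p by (intro powr_mono2) auto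
    also have "\<dots> = 2 powr p * max ?a ?b powr p" by (simp add: powr_mult)
    also have "\<dots> \<le> 2 powr p * (?a powr p + ?b powr p)" by (intro mult_left_mono) (auto simp: max_def)
    finally show "ennreal (cmod (suminf x) powr p) \<le> ennreal (2 powr p) * (ennreal (?a powr p) + ennreal (?b powr p))"
      by (simp add: ennreal_mult[symmetric] ennreal_plus[symmetric] del: ennreal_plus)
  qed
  also have "\<dots> = ennreal (2 powr p) * ((\<integral>\<^sup>+x. ennreal (cmod (suminf x - suminf y) powr p) \<partial>law) + ennreal (cmod (suminf y) powr p))"
    by (simp add: nn_integral_cmult nn_integral_add law.emeasure_space_1[unfolded space_law])
  also have "\<dots> < \<infinity>" using y by (simp add: ennreal_mult_less_top less_top)
  finally show ?thesis .
qed

end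

section \<open>Increments of a convergent sequence of generation sums\<close>

text \<open>
  For complex terms unordered summability is absolute summability, which is a measurable condition;
  so the unordered sum is measurable even where its value is the default 0.
\<close>

lemma borel_measurable_infsum_complex:
  fixes f :: "'i::countable \<Rightarrow> 'a \<Rightarrow> complex"
  assumes f [measurable]: "\<And>i. f i \<in> borel_measurable M"
  shows "(\<lambda>x. \<Sum>\<^sub>\<infinity>i. f i x) \<in> borel_measurable M"
proof -
  define g where "g k x = (if k \<in> range (to_nat :: 'i \<Rightarrow> nat) then f (from_nat k) x else 0)" for k x
  have [measurable]: "g k \<in> borel_measurable M" for k unfolding g_def[abs_def] by measurable
  have "(\<Sum>\<^sub>\<infinity>i. f i x) = (if (\<Sum>k. ennreal (cmod (g k x))) \<noteq> \<top> then (\<Sum>k. g k x) else 0)" for x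
  proof -
    have "(\<Sum>\<^sub>\<infinity>k\<in>range (to_nat :: 'i \<Rightarrow> nat). g k x) = infsum ((\<lambda>k. g k x) \<circ> to_nat) (UNIV :: 'i set)"
      by (rule infsum_reindex) simp
    also have "(\<lambda>k. g k x) \<circ> to_nat = (\<lambda>i. f i x)" by (simp add: fun_eq_iff g_def)
    finally have 1: "(\<Sum>\<^sub>\<infinity>k\<in>range (to_nat :: 'i \<Rightarrow> nat). g k x) = (\<Sum>\<^sub>\<infinity>i. f i x)" .
    have 2: "(\<Sum>\<^sub>\<infinity>k\<in>range (to_nat :: 'i \<Rightarrow> nat). g k x) = (\<Sum>\<^sub>\<infinity>k. g k x)"
      by (rule infsum_cong_neutral) (simp_all add: g_def)
    have *: "(\<Sum>\<^sub>\<infinity>i. f i x) = (\<Sum>\<^sub>\<infinity>k. g k x)" by (rule trans[OF sym[OF 1] 2])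
    show ?thesis
    proof (cases "summable (\<lambda>k. cmod (g k x))")
      case True
      have eq: "(\<Sum>\<^sub>\<infinity>k. g k x) = (\<Sum>k. g k x)"
        by (rule infsumI, rule norm_summable_imp_has_sum[OF True]) (rule summable_sums[OF summable_norm_cancel[OF True]])
      have "(\<Sum>k. ennreal (cmod (g k x))) \<noteq> \<top>" by (rule ennreal_suminf_neq_top[OF True]) (rule norm_ge_zero)
      then show ?thesis unfolding * eq by (simp only: not_False_eq_True if_True)
    next
      case False
      then have "\<not> (\<lambda>k. cmod (g k x)) summable_on UNIV"
        by (subst summable_on_UNIV_nonneg_real_iff) (rule norm_ge_zero)
      then have "\<not> (\<lambda>k. g k x) summable_on UNIV"
        by (subst summable_on_iff_abs_summable_on_complex)
      then have "(\<Sum>\<^sub>\<infinity>k. g k x) = 0" by (rule infsum_not_exists)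
      moreover have "(\<Sum>k. ennreal (cmod (g k x))) = \<top>"
        using False summable_suminf_not_top[of "\<lambda>k. cmod (g k x)"] norm_ge_zero by blast
      ultimately show ?thesis unfolding * by (simp only: if_False simp_thms)
    qed
  qed
  then have "(\<lambda>x. \<Sum>\<^sub>\<infinity>i. f i x) = (\<lambda>x. if (\<Sum>k. ennreal (cmod (g k x))) \<noteq> \<top> then (\<Sum>k. g k x) else 0)" by (rule ext)
  then show ?thesis by (simp only:) measurable
qed

lemma converges_in_probability_increments:
  fixes Z :: "nat \<Rightarrow> 'w \<Rightarrow> complex"
  assumes "prob_space M" and Z [measurable]: "\<And>n. Z n \<in> borel_measurable M"
    and conv: "converges_in_probability M Z" and \<epsilon>: "0 < \<epsilon>"
  shows "(\<lambda>n. measure M {\<omega>\<in>space M. \<epsilon> < cmod (Z (Suc n) \<omega> - Z n \<omega>)}) \<longlonglongrightarrow> 0"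
proof -
  interpret prob_space M by fact
  obtain W where [measurable]: "W \<in> borel_measurable M"
    and W: "\<And>\<epsilon>. 0 < \<epsilon> \<Longrightarrow> (\<lambda>n. measure M {\<omega>\<in>space M. dist (Z n \<omega>) (W \<omega>) > \<epsilon>}) \<longlonglongrightarrow> 0"
    using conv unfolding converges_in_probability_def by blast
  let ?p = "\<lambda>n. measure M {\<omega>\<in>space M. dist (Z n \<omega>) (W \<omega>) > \<epsilon> / 2}"
  have p: "?p \<longlonglongrightarrow> 0" using W[of "\<epsilon> / 2"] \<epsilon> by simp
  have bound: "measure M {\<omega>\<in>space M. \<epsilon> < cmod (Z (Suc n) \<omega> - Z n \<omega>)} \<le> ?p (Suc n) + ?p n" for n
  proof -
    have "{\<omega>\<in>space M. \<epsilon> < cmod (Z (Suc n) \<omega> - Z n \<omega>)} \<subseteq>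
        {\<omega>\<in>space M. dist (Z (Suc n) \<omega>) (W \<omega>) > \<epsilon> / 2} \<union> {\<omega>\<in>space M. dist (Z n \<omega>) (W \<omega>) > \<epsilon> / 2}"
    proof
      fix \<omega> assume \<omega>: "\<omega> \<in> {\<omega>\<in>space M. \<epsilon> < cmod (Z (Suc n) \<omega> - Z n \<omega>)}"
      have "cmod (Z (Suc n) \<omega> - Z n \<omega>) \<le> dist (Z (Suc n) \<omega>) (W \<omega>) + dist (Z n \<omega>) (W \<omega>)"
        using dist_triangle2[of "Z (Suc n) \<omega>" "Z n \<omega>" "W \<omega>"] by (simp add: dist_norm)
      with \<omega> show "\<omega> \<in> {\<omega>\<in>space M. dist (Z (Suc n) \<omega>) (W \<omega>) > \<epsilon> / 2} \<union> {\<omega>\<in>space M. dist (Z n \<omega>) (W \<omega>) > \<epsilon> / 2}"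
        by auto
    qed
    then have "measure M {\<omega>\<in>space M. \<epsilon> < cmod (Z (Suc n) \<omega> - Z n \<omega>)} \<le>
        measure M ({\<omega>\<in>space M. dist (Z (Suc n) \<omega>) (W \<omega>) > \<epsilon> / 2} \<union> {\<omega>\<in>space M. dist (Z n \<omega>) (W \<omega>) > \<epsilon> / 2})"
      by (intro finite_measure_mono) measurable
    also have "\<dots> \<le> ?p (Suc n) + ?p n" by (intro measure_Un_le) measurable
    finally show ?thesis .
  qed
  show ?thesis
  proof (rule tendsto_sandwich[of "\<lambda>_. 0" _ _ "\<lambda>n. ?p (Suc n) + ?p n"])
    show "(\<lambda>n. ?p (Suc n) + ?p n) \<longlonglongrightarrow> 0"
      using tendsto_add[OF LIMSEQ_Suc[OF p] p] by simp
  qed (use bound in auto)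
qed

context branching_weights begin

text \<open>
  The individuals of generation \<open>n\<close>, recognised by their nonzero weights.
\<close>

definition alive :: "nat \<Rightarrow> 'w \<Rightarrow> nat list set" where
  "alive n \<omega> = {u. length u = n \<and> wt u \<omega> \<noteq> 0}"

lemma alive_0: "alive 0 \<omega> = {[]}"
  by (auto simp: alive_def wt_Nil)

lemma alive_Suc: "alive (Suc n) \<omega> = (\<lambda>(u, j). u @ [j]) ` (SIGMA u:alive n \<omega>. {j. T u \<omega> j \<noteq> 0})"
proof (intro set_eqI iffI)
  fix v assume v: "v \<in> alive (Suc n) \<omega>"
  then obtain u j where "v = u @ [j]" by (cases v rule: rev_cases) (auto simp: alive_def)
  with v show "v \<in> (\<lambda>(u, j). u @ [j]) ` (SIGMA u:alive n \<omega>. {j. T u \<omega> j \<noteq> 0})"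
    by (intro image_eqI[of _ _ "(u, j)"]) (auto simp: alive_def wt_snoc)
qed (auto simp: alive_def wt_snoc)

lemma alive_tuples: "alive n \<omega> \<subseteq> tuples"
proof (induction n)
  case (Suc n)
  show ?case unfolding alive_Suc
  proof clarsimp
    fix u j assume "u \<in> alive n \<omega>" "T u \<omega> j \<noteq> 0"
    moreover from this have "j \<noteq> 0" by (metis T_0)
    ultimately show "u @ [j] \<in> tuples" using Suc by (auto simp: tuples_def)
  qed
qed (simp add: alive_0 Nil_tuples)

lemma AE_finite_offspring: "AE \<omega> in M. \<forall>u\<in>tuples. finite {j. T u \<omega> j \<noteq> 0}"
proof -
  have "AE \<omega> in M. finite {j. T u \<omega> j \<noteq> 0}" if u: "u \<in> tuples" for u
  proof -
    have "AE x in distr M seq_space (T u). x 0 = 0 \<and> finite {j. x j \<noteq> 0}"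
      using AE_law unfolding T_law[OF u] law_def .
    from AE_distrD[OF T_measurable[OF u] this] show ?thesis by eventually_elim simp
  qed
  then show ?thesis by (subst AE_ball_countable) auto
qed

lemma finite_alive:
  assumes "\<forall>u\<in>tuples. finite {j. T u \<omega> j \<noteq> 0}"
  shows "finite (alive n \<omega>)"
proof (induction n)
  case (Suc n)
  then show ?case unfolding alive_Suc
    by (intro finite_imageI finite_SigmaI) (use alive_tuples assms in auto)
qed (simp add: alive_0)

text \<open>
  On a tree with finite generations, the sequence is constant as soon as the alphabet contains all
  labels of the generation.
\<close>

lemma sum_increments_tendsto:
  assumes fin: "\<forall>u\<in>tuples. finite {j. T u \<omega> j \<noteq> 0}"
  shows "(\<lambda>m. \<Sum>u\<in>words m n. wt u \<omega> * (suminf (T u \<omega>) - 1)) \<longlonglongrightarrow>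
    (\<Sum>u\<in>alive (Suc n) \<omega>. wt u \<omega>) - (\<Sum>u\<in>alive n \<omega>. wt u \<omega>)"
proof -
  have "finite (\<Union>u\<in>alive n \<omega>. set u)" using finite_alive[OF fin] by auto
  then obtain m0 where m0: "\<And>u j. u \<in> alive n \<omega> \<Longrightarrow> j \<in> set u \<Longrightarrow> j \<le> m0"
    by (auto simp: finite_nat_set_iff_bounded_le)
  have "(\<Sum>u\<in>words m n. wt u \<omega> * (suminf (T u \<omega>) - 1)) =
      (\<Sum>u\<in>alive (Suc n) \<omega>. wt u \<omega>) - (\<Sum>u\<in>alive n \<omega>. wt u \<omega>)" if "m0 \<le> m" for m
  proof -
    have sub: "alive n \<omega> \<subseteq> words m n"
      using m0 that alive_tuples[of n \<omega>] by (force simp: words_def alive_def tuples_def)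
    have "(\<Sum>u\<in>words m n. wt u \<omega> * (suminf (T u \<omega>) - 1)) = (\<Sum>u\<in>alive n \<omega>. wt u \<omega> * (suminf (T u \<omega>) - 1))"
      by (rule sum.mono_neutral_right[OF finite_words sub]) (auto simp: alive_def words_def)
    also have "\<dots> = (\<Sum>u\<in>alive n \<omega>. \<Sum>j\<in>{j. T u \<omega> j \<noteq> 0}. wt (u @ [j]) \<omega>) - (\<Sum>u\<in>alive n \<omega>. wt u \<omega>)"
      unfolding sum_subtractf[symmetric]
    proof (rule sum.cong[OF refl])
      fix u assume "u \<in> alive n \<omega>"
      then have "finite {j. T u \<omega> j \<noteq> 0}" using fin alive_tuples by blast
      then have "suminf (T u \<omega>) = (\<Sum>j\<in>{j. T u \<omega> j \<noteq> 0}. T u \<omega> j)"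
        by (intro suminf_finite) auto
      then show "wt u \<omega> * (suminf (T u \<omega>) - 1) = (\<Sum>j\<in>{j. T u \<omega> j \<noteq> 0}. wt (u @ [j]) \<omega>) - wt u \<omega>"
        by (simp add: wt_snoc sum_distrib_left[symmetric] right_diff_distrib)
    qed
    also have "(\<Sum>u\<in>alive n \<omega>. \<Sum>j\<in>{j. T u \<omega> j \<noteq> 0}. wt (u @ [j]) \<omega>) = (\<Sum>(u, j)\<in>(SIGMA u:alive n \<omega>. {j. T u \<omega> j \<noteq> 0}). wt (u @ [j]) \<omega>)"
      by (rule sum.Sigma) (use finite_alive[OF fin] in simp, use fin alive_tuples in blast)
    also have "\<dots> = (\<Sum>u\<in>alive (Suc n) \<omega>. wt u \<omega>)"
      unfolding alive_Suc by (subst sum.reindex) (auto simp: inj_on_def case_prod_beta comp_def)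
    finally show ?thesis .
  qed
  then show ?thesis
    by (intro tendsto_eventually eventually_sequentiallyI)
qed

lemma convergence_imp_child_sum_moment:
  fixes \<alpha> p :: real and Z :: "nat \<Rightarrow> 'w \<Rightarrow> complex"
  assumes Z [measurable]: "\<And>n. Z n \<in> borel_measurable M"
    and Z_eq: "\<And>n. AE \<omega> in M. Z n \<omega> = (\<Sum>u\<in>alive n \<omega>. wt u \<omega>)"
    and conv: "converges_in_probability M Z"
    and p: "0 < p" "p < \<alpha>"
    and mean_\<alpha>: "(\<integral>\<^sup>+x. (\<Sum>j. ennreal (cmod (x j) powr \<alpha>)) \<partial>law) = 1"
    and log_int: "integrable law (\<lambda>x. \<Sum>j. cmod (x j) powr \<alpha> * ln (cmod (x j)))"
    and log_le: "(\<integral>x. (\<Sum>j. cmod (x j) powr \<alpha> * ln (cmod (x j))) \<partial>law) \<le> 0"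
    and count: "1 < (\<integral>\<^sup>+x. (\<Sum>j. of_bool (x j \<noteq> 0)) \<partial>law)"
  shows "(\<integral>\<^sup>+x. ennreal (cmod (suminf x) powr p) \<partial>law) < \<infinity>"
proof (rule child_sum_moment_finite[OF _ _ p])
  have lim: "AE \<omega> in M. (\<lambda>m. \<Sum>u\<in>words m n. wt u \<omega> * (suminf (T u \<omega>) - 1)) \<longlonglongrightarrow> Z (Suc n) \<omega> - Z n \<omega>" for n
    using AE_finite_offspring Z_eq[of n] Z_eq[of "Suc n"]
  proof eventually_elim
    case (elim \<omega>)
    then show ?case using sum_increments_tendsto[OF elim(1), of n] by (simp only: elim(2,3))
  qed
  show "(\<lambda>n. (offspring_op K ^^ n) symm_tail 1) \<longlonglongrightarrow> 0" for K
  proof (rule symm_tail_iter_tendsto_0, rule prod_char_tendsto_1[OF _ lim])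
    show "(\<lambda>\<omega>. Z (Suc n) \<omega> - Z n \<omega>) \<in> borel_measurable M" for n by measurable
    show "(\<lambda>n. measure M {\<omega>\<in>space M. \<epsilon> < cmod (Z (Suc n) \<omega> - Z n \<omega>)}) \<longlonglongrightarrow> 0" if "0 < \<epsilon>" for \<epsilon>
      by (rule converges_in_probability_increments[OF prob_space_axioms Z conv that])
  qed
  show "\<exists>K>0.
      1 < (\<integral>x. (\<Sum>j\<in>{1..K}. if 0 < cmod (x j) \<and> \<bar>ln (cmod (x j))\<bar> \<le> real K then cmod (x j) powr s else 0) \<partial>law) \<and>
      0 < (\<integral>x. (\<Sum>j\<in>{1..K}. if 0 < cmod (x j) \<and> \<bar>ln (cmod (x j))\<bar> \<le> real K
              then - ln (cmod (x j)) * cmod (x j) powr s else 0) \<partial>law)" if "s < \<alpha>" for s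
    by (rule truncated_tilted_means[OF that mean_\<alpha> log_int log_le count]) blast
qed

end

section \<open>The branching random walk\<close>

lemma cdot_sum: "cdot lam (\<Sum>k\<in>A. f k) = (\<Sum>k\<in>A. cdot lam (f k))"
  unfolding cdot_def by (simp add: sum_distrib_left) (rule sum.swap)

lemma cdot_measurable [measurable]: "cdot lam \<in> borel_measurable borel"
  unfolding cdot_def[abs_def] by measurable

text \<open>
  The factors must depend on the process only through its masked points, because independence and
  equality in law are assumed for these.
\<close>

definition child_factor :: "complex ^ 'd \<Rightarrow> complex \<Rightarrow> enat \<times> (nat \<Rightarrow> real ^ 'd) \<Rightarrow> nat \<Rightarrow> complex" where
  "child_factor lam m d j = (if j \<in> labels (fst d) then exp (- cdot lam (snd d j)) / m else 0)"

lemma child_factor_measurable: "child_factor lam m \<in> measurable point_data_space seq_space"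
proof (rule measurable_PiM_single')
  fix j
  have "Measurable.pred point_data_space (\<lambda>d. j \<in> labels (fst d))"
    by (rule measurable_compose[OF measurable_fst]) simp
  then show "(\<lambda>d. child_factor lam m d j) \<in> borel_measurable point_data_space"
    unfolding child_factor_def[abs_def] by measurable
qed auto

lemma generation_iff:
  "u \<in> generation N (length u) \<omega> \<longleftrightarrow> (\<forall>k<length u. u ! k \<in> labels (N (take k u) \<omega>))"
proof (induction u rule: rev_induct)
  case (snoc j u)
  have "u @ [j] \<in> generation N (length (u @ [j])) \<omega> \<longleftrightarrow> u \<in> generation N (length u) \<omega> \<and> j \<in> labels (N u \<omega>)"
    by auto
  also have "\<dots> \<longleftrightarrow> (\<forall>k<length (u @ [j]). (u @ [j]) ! k \<in> labels (N (take k (u @ [j])) \<omega>))"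
    unfolding snoc.IH by (auto simp: nth_append less_Suc_eq)
  finally show ?case .
qed simp

lemma length_generation: "u \<in> generation N n \<omega> \<Longrightarrow> length u = n"
  by (induction n arbitrary: u) auto

theorem proposition2p3:
  fixes M :: "'w measure"
    and N :: "nat list \<Rightarrow> 'w \<Rightarrow> enat"
    and X :: "nat list \<Rightarrow> nat \<Rightarrow> 'w \<Rightarrow> real ^ 'd"
    and lam :: "complex ^ 'd"
    and \<alpha> \<theta> p :: real
  defines "\<mu> \<equiv> mean_measure M N X"
    and "L \<equiv> weight M N X lam"
    and "Z \<equiv> additive_martingale M N X lam"
    and "G \<equiv> generation N"
  assumes "prob_space M"
    and "iid_point_processes M N X"
    and "emeasure \<mu> UNIV > 1"
    and "interior (laplace_domain \<mu>) \<noteq> {}"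
    and "lam \<in> laplace_domain \<mu>"
    and "laplace \<mu> lam \<noteq> 0"
    and "measure M {\<omega>\<in>space M. Z 1 \<omega> = 1} < 1"
    and "measure M {\<omega>\<in>space M. N [] \<omega> < \<infinity>} = 1"
    and "1 < \<alpha>" and "\<alpha> \<le> 2"
    and "(\<integral>\<^sup>+ \<omega>. (\<Sum>\<^sub>\<infinity>u\<in>G 1 \<omega>. ennreal (cmod (L u \<omega>) powr \<alpha>)) \<partial>M) = 1"
    and "integrable M (\<lambda>\<omega>. \<Sum>\<^sub>\<infinity>u\<in>G 1 \<omega>. cmod (L u \<omega>) powr \<alpha> * ln (cmod (L u \<omega>)))"
    and "(\<integral>\<omega>. (\<Sum>\<^sub>\<infinity>u\<in>G 1 \<omega>. cmod (L u \<omega>) powr \<alpha> * ln (cmod (L u \<omega>))) \<partial>M) \<le> 0"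
    and "0 \<le> \<theta>" and "\<theta> < \<alpha>"
    and "(\<integral>\<^sup>+ \<omega>. (\<Sum>\<^sub>\<infinity>u\<in>G 1 \<omega>. ennreal (cmod (L u \<omega>) powr \<theta>)) \<partial>M) < \<infinity>"
    and "1 \<le> p" and "p < \<alpha>"
    and "(\<integral>\<^sup>+ \<omega>. ennreal (cmod (Z 1 \<omega>) powr p) \<partial>M) = \<infinity>"
  shows "\<not> converges_in_probability M Z"
proof
  assume conv: "converges_in_probability M Z"
  interpret prob_space M by fact
  define m where "m = laplace \<mu> lam"
  have m0: "m \<noteq> 0" using assms(10) by (simp add: m_def)
  define T where "T u \<omega> = child_factor lam m (point_data N X u \<omega>)" for u \<omega>
  have T_eq: "T u \<omega> j = (if j \<in> labels (N u \<omega>) then exp (- cdot lam (X u j \<omega>)) / m else 0)" for u \<omega> j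
    by (simp add: T_def child_factor_def point_data_def)
  have T_nz: "T u \<omega> j \<noteq> 0 \<longleftrightarrow> j \<in> labels (N u \<omega>)" for u \<omega> j using m0 by (simp add: T_eq)
  have iid: "\<forall>u\<in>tuples. N u \<in> measurable M (count_space UNIV)" "\<forall>u\<in>tuples. \<forall>j. X u j \<in> borel_measurable M"
    "indep_vars (\<lambda>_. point_data_space) (point_data N X) tuples"
    "\<And>u. u \<in> tuples \<Longrightarrow> distr M point_data_space (point_data N X u) = distr M point_data_space (point_data N X [])"
    using assms(6) unfolding iid_point_processes_def by auto
  have Nil: "[] \<in> tuples" by (simp add: tuples_def)
  have pd: "point_data N X u \<in> measurable M point_data_space" if "u \<in> tuples" for u
    using iid(3) that by (auto simp: indep_vars_def2)
  have N_meas [measurable]: "N [] \<in> measurable M (count_space UNIV)" using iid(1) Nil by blast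
  have X_meas: "X [] j \<in> borel_measurable M" for j using iid(2) Nil by blast
  have fin0: "AE \<omega> in M. finite (labels (N [] \<omega>))"
  proof -
    have "{\<omega>\<in>space M. N [] \<omega> < \<infinity>} \<in> sets M" by measurable
    then have "AE \<omega> in M. N [] \<omega> < \<infinity>" using assms(12) by (simp add: prob_Collect_eq_1)
    then show ?thesis
    proof eventually_elim
      case (elim \<omega>)
      then obtain k where "N [] \<omega> = enat k" by (auto simp: less_infinityE)
      then have "labels (N [] \<omega>) \<subseteq> {..k}" by (auto simp: labels_def)
      then show ?case by (rule finite_subset) simp
    qed
  qed
  interpret W: branching_weights M T
  proof
    show "indep_vars (\<lambda>_. seq_space) T tuples"
      unfolding T_def[abs_def] by (rule indep_vars_compose2[OF iid(3) child_factor_measurable])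
    show "distr M seq_space (T u) = distr M seq_space (T [])" if "u \<in> tuples" for u
    proof -
      have "distr M seq_space (T v) = distr (distr M point_data_space (point_data N X v)) seq_space (child_factor lam m)"
        if "v \<in> tuples" for v
        unfolding T_def[abs_def] by (subst distr_distr[OF child_factor_measurable pd[OF that]]) (simp add: comp_def)
      from this[OF that] this[OF Nil] show ?thesis by (simp only: iid(4)[OF that])
    qed
    show "T u \<omega> 0 = 0" for u \<omega> by (simp add: T_eq labels_def)
    show "AE \<omega> in M. finite {j. T [] \<omega> j \<noteq> 0}" using fin0 by (simp only: T_nz Collect_mem_eq)
  qed
  have wt: "W.wt u \<omega> = weight M N X lam u \<omega>" for u \<omega>
  proof (cases "u \<in> generation N (length u) \<omega>")
    case True
    have "W.wt u \<omega> = (\<Prod>k<length u. exp (- cdot lam (X (take k u) (u ! k) \<omega>)) / m)"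
      unfolding W.wt_def by (rule prod.cong) (use True[unfolded generation_iff] in \<open>auto simp: T_eq\<close>)
    also have "\<dots> = exp (- cdot lam (position X u \<omega>)) / m ^ length u"
      by (simp only: prod_dividef exp_sum[OF finite_lessThan, symmetric] sum_negf position_def cdot_sum prod_constant card_lessThan)
    finally show ?thesis using True by (simp add: weight_def m_def \<mu>_def)
  next
    case False
    then obtain k where "k < length u" "u ! k \<notin> labels (N (take k u) \<omega>)" unfolding generation_iff by blast
    then have "W.wt u \<omega> = 0" unfolding W.wt_def by (intro prod_zero bexI[of _ k]) (simp_all add: T_eq)
    with False show ?thesis by (simp add: weight_def)
  qed
  have wt_nz: "W.wt u \<omega> \<noteq> 0 \<longleftrightarrow> u \<in> generation N (length u) \<omega>" for u \<omega>
    unfolding wt weight_def using m0[unfolded m_def \<mu>_def] by simp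
  have alive: "W.alive n \<omega> = G n \<omega>" for n \<omega>
  proof (rule set_eqI)
    fix u
    have "u \<in> W.alive n \<omega> \<longleftrightarrow> length u = n \<and> u \<in> generation N (length u) \<omega>"
      unfolding W.alive_def wt_nz by (rule mem_Collect_eq)
    also have "\<dots> \<longleftrightarrow> u \<in> G n \<omega>" unfolding G_def using length_generation[of u N n \<omega>] by auto
    finally show "u \<in> W.alive n \<omega> \<longleftrightarrow> u \<in> G n \<omega>" .
  qed
  have Z_measurable: "Z n \<in> borel_measurable M" for n
  proof -
    have Z_alt: "Z n \<omega> = (\<Sum>\<^sub>\<infinity>u. if u \<in> tuples \<and> length u = n then W.wt u \<omega> else 0)" for \<omega>
      unfolding Z_def additive_martingale_def
    proof (rule infsum_cong_neutral)
      fix u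
      show "(if u \<in> tuples \<and> length u = n then W.wt u \<omega> else 0) = 0" if "u \<in> UNIV - generation N n \<omega>"
        using that wt_nz[of u \<omega>] by auto
      show "weight M N X lam u \<omega> = (if u \<in> tuples \<and> length u = n then W.wt u \<omega> else 0)"
        if "u \<in> generation N n \<omega> \<inter> UNIV"
        using that length_generation[of u N n \<omega>] W.alive_tuples[of n \<omega>] by (auto simp: wt alive G_def)
    qed auto
    have "(\<lambda>\<omega>. if u \<in> tuples \<and> length u = n then W.wt u \<omega> else 0) \<in> borel_measurable M" for u
      using W.wt_measurable by (cases "u \<in> tuples \<and> length u = n") auto
    then have "(\<lambda>\<omega>. \<Sum>\<^sub>\<infinity>u. if u \<in> tuples \<and> length u = n then W.wt u \<omega> else 0) \<in> borel_measurable M"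
      by (rule borel_measurable_infsum_complex)
    then show ?thesis by (simp add: Z_alt[symmetric])
  qed
  have Z_eq: "AE \<omega> in M. Z n \<omega> = (\<Sum>u\<in>W.alive n \<omega>. W.wt u \<omega>)" for n
    using W.AE_finite_offspring
  proof eventually_elim
    case (elim \<omega>)
    from W.finite_alive[OF this, of n] show ?case
      unfolding Z_def additive_martingale_def alive G_def wt by simp
  qed
  have G1: "G 1 \<omega> = (\<lambda>j. [j]) ` labels (N [] \<omega>)" for \<omega> by (auto simp: G_def)
  have L1: "L [j] \<omega> = T [] \<omega> j" for j \<omega>
    using wt[of "[j]" \<omega>] W.wt_snoc[of "[]" j \<omega>] W.wt_Nil by (simp add: L_def)
  have first: "infsum (\<lambda>u. f (L u \<omega>)) (G 1 \<omega>) = (\<Sum>j. f (T [] \<omega> j))"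
    if "finite (labels (N [] \<omega>))" "f 0 = 0" for f :: "complex \<Rightarrow> 'b :: {t2_space, topological_comm_monoid_add}" and \<omega>
  proof -
    have "infsum (\<lambda>u. f (L u \<omega>)) (G 1 \<omega>) = (\<Sum>u\<in>G 1 \<omega>. f (L u \<omega>))"
      by (rule infsum_finite) (simp only: G1 finite_imageI that)
    also have "\<dots> = (\<Sum>j\<in>labels (N [] \<omega>). f (T [] \<omega> j))"
      unfolding G1 by (subst sum.reindex) (auto simp: inj_on_def L1)
    also have "\<dots> = (\<Sum>j. f (T [] \<omega> j))"
      by (rule suminf_finite[symmetric]) (use that in \<open>simp_all add: T_eq\<close>)
    finally show ?thesis .
  qed
  note T_meas = W.T_measurable[OF Nil]
  have law_nn: "(\<integral>\<^sup>+x. f x \<partial>W.law) = (\<integral>\<^sup>+\<omega>. f (T [] \<omega>) \<partial>M)" if "f \<in> borel_measurable seq_space" for f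
    unfolding W.law_def by (rule nn_integral_distr[OF T_meas]) (simp add: that)
  have mean: "(\<integral>\<^sup>+x. (\<Sum>j. ennreal (cmod (x j) powr \<alpha>)) \<partial>W.law) = 1"
  proof -
    have "(\<integral>\<^sup>+x. (\<Sum>j. ennreal (cmod (x j) powr \<alpha>)) \<partial>W.law) = (\<integral>\<^sup>+\<omega>. (\<Sum>j. ennreal (cmod (T [] \<omega> j) powr \<alpha>)) \<partial>M)"
      by (rule law_nn) measurable
    also have "\<dots> = (\<integral>\<^sup>+ \<omega>. (\<Sum>\<^sub>\<infinity>u\<in>G 1 \<omega>. ennreal (cmod (L u \<omega>) powr \<alpha>)) \<partial>M)"
    proof (rule nn_integral_cong_AE, use fin0 in eventually_elim)
      fix \<omega> assume "finite (labels (N [] \<omega>))"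
      then show "(\<Sum>j. ennreal (cmod (T [] \<omega> j) powr \<alpha>)) = (\<Sum>\<^sub>\<infinity>u\<in>G 1 \<omega>. ennreal (cmod (L u \<omega>) powr \<alpha>))"
        by (rule first[symmetric]) simp
    qed
    also note assms(15)
    finally show ?thesis .
  qed
  let ?l = "\<lambda>x. \<Sum>j. cmod (x j) powr \<alpha> * ln (cmod (x j :: complex))"
  have l_meas: "?l \<in> borel_measurable seq_space" by measurable
  have l_AE: "AE \<omega> in M. ?l (T [] \<omega>) = (\<Sum>\<^sub>\<infinity>u\<in>G 1 \<omega>. cmod (L u \<omega>) powr \<alpha> * ln (cmod (L u \<omega>)))"
    using fin0
  proof eventually_elim
    case (elim \<omega>)
    then show ?case by (rule first[symmetric]) simp
  qed
  have lT_meas: "(\<lambda>\<omega>. ?l (T [] \<omega>)) \<in> borel_measurable M"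
    using measurable_compose[OF T_meas l_meas] .
  have l_M: "integrable M (\<lambda>\<omega>. ?l (T [] \<omega>))" "(\<integral>\<omega>. ?l (T [] \<omega>) \<partial>M) \<le> 0"
  proof -
    note meas = lT_meas borel_measurable_integrable[OF assms(16)]
    show "integrable M (\<lambda>\<omega>. ?l (T [] \<omega>))"
      by (rule integrable_cong_AE[OF meas l_AE, THEN iffD2, OF assms(16)])
    show "(\<integral>\<omega>. ?l (T [] \<omega>) \<partial>M) \<le> 0"
      unfolding integral_cong_AE[OF meas l_AE] by (rule assms(17))
  qed
  have l_law: "integrable W.law ?l" "(\<integral>x. ?l x \<partial>W.law) \<le> 0"
    unfolding W.law_def using l_M by (simp_all only: integrable_distr_eq[OF T_meas l_meas] integral_distr[OF T_meas l_meas])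
  have count: "1 < (\<integral>\<^sup>+x. (\<Sum>j. of_bool (x j \<noteq> 0)) \<partial>W.law)"
  proof -
    have "(\<integral>\<^sup>+x. (\<Sum>j. of_bool (x j \<noteq> 0)) \<partial>W.law) = (\<integral>\<^sup>+\<omega>. (\<Sum>j. of_bool (T [] \<omega> j \<noteq> 0)) \<partial>M)"
      by (rule law_nn) measurable
    also have "\<dots> = (\<integral>\<^sup>+\<omega>. emeasure (point_process (N []) (X []) \<omega>) UNIV \<partial>M)"
      by (simp only: emeasure_point_process[OF space_in_borel] T_nz) (simp add: indicator_def of_bool_def)
    also have "\<dots> = emeasure \<mu> UNIV"
      unfolding \<mu>_def mean_measure_def by (rule emeasure_intensity[symmetric]) (use X_meas in auto)
    finally show ?thesis using assms(7) by (simp only:)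
  qed
  have "(\<integral>\<^sup>+x. ennreal (cmod (suminf x) powr p) \<partial>W.law) < \<infinity>"
    by (rule W.convergence_imp_child_sum_moment[OF Z_measurable Z_eq conv _ _ mean l_law count]) (use assms(21,22) in auto)
  also have "(\<integral>\<^sup>+x. ennreal (cmod (suminf x) powr p) \<partial>W.law) = (\<integral>\<^sup>+\<omega>. ennreal (cmod (suminf (T [] \<omega>)) powr p) \<partial>M)"
    by (rule law_nn) (use W.suminf_measurable in \<open>simp add: measurable_cong_sets[OF W.sets_law refl]\<close>)
  also have "\<dots> = (\<integral>\<^sup>+\<omega>. ennreal (cmod (Z 1 \<omega>) powr p) \<partial>M)"
  proof (rule nn_integral_cong_AE, use fin0 in eventually_elim)
    fix \<omega> assume "finite (labels (N [] \<omega>))"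
    from first[OF this, of "\<lambda>c. c"] have "Z 1 \<omega> = suminf (T [] \<omega>)"
      by (simp add: Z_def additive_martingale_def L_def G_def)
    then show "ennreal (cmod (suminf (T [] \<omega>)) powr p) = ennreal (cmod (Z 1 \<omega>) powr p)" by simp
  qed
  also note assms(23)
  finally show False by simp
qed

end
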